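(* Let $\varepsilon>0$, $U_0>0$, $V_0>0$. Then there exists a unique solution $f$, with associated free-boundary position $a\in\mathbb{R}$, of the problem $$\begin{aligned} &-\tfrac12\eta f'(\eta)=[\phi'(f(\eta))f'(\eta)]' &&\text{if }\eta<a,\\ &-\tfrac12\eta f'(\eta)=[\varepsilon\phi'(-f(\eta))f'(\eta)]' &&\text{if }\eta>a,\\ &\lim_{\eta\to-\infty}f(\eta)=U_0,\qquad \lim_{\eta\to\infty}f(\eta)=-V_0,\\ &\lim_{\eta\nearrow a}f(\eta)=0=-\lim_{\eta\searrow a}f(\eta),\\ &\lim_{\eta\nearrow a}\phi'(f(\eta))f'(\eta)=\varepsilon\lim_{\eta\searrow a}\phi'(-f(\eta))f'(\eta), \end{aligned}$$ where a prime on $f$ or on a bracket denotes differentiation with respect to $\eta$.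
   Context: $\phi\in C^2(\mathbb{R})$ is such that $\phi$ and $\phi'$ are strictly increasing on $[0,\infty)$, $\phi(s)>0$ for $s>0$, $\phi(0)=\phi'(0)=0$, and $\int_0^1\frac{\phi'(s)}{s}\,ds<\infty$, $\int_1^\infty\frac{\phi'(s)}{s}\,ds=\infty$. The constant $a\in\mathbb{R}$ is part of the unknown. A solution is a continuous function $f:\mathbb{R}\to\mathbb{R}$ together with $a\in\mathbb{R}$ such that $f>0$ on $(-\infty,a)$, $f<0$ on $(a,\infty)$, $f$ is $C^2$ on $(-\infty,a)$ and on $(a,\infty)$, and all the relations hold. *)

theory Defs
  imports "HOL-Analysis.Analysis"
begin

text \<open>Meant for open \<open>S\<close>; the derivatives are two-sided.\<close>

definition C2_on :: "real set \<Rightarrow> (real \<Rightarrow> real) \<Rightarrow> bool" where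
  "C2_on S f \<longleftrightarrow>
     (\<forall>x\<in>S. f field_differentiable (at x)) \<and>
     (\<forall>x\<in>S. deriv f field_differentiable (at x)) \<and>
     continuous_on S (deriv (deriv f))"

text \<open>
  In the last conjunct, the one-sided limits of the fluxes are required to exist as real numbers
  \<open>l\<close> and \<open>r\<close>.
\<close>

definition free_boundary_solution ::
    "(real \<Rightarrow> real) \<Rightarrow> real \<Rightarrow> real \<Rightarrow> real \<Rightarrow> (real \<Rightarrow> real) \<Rightarrow> real \<Rightarrow> bool" where
  "free_boundary_solution \<phi> \<epsilon> U\<^sub>0 V\<^sub>0 f a \<longleftrightarrow>
     continuous_on UNIV f \<and>
     (\<forall>\<eta><a. f \<eta> > 0) \<and> (\<forall>\<eta>>a. f \<eta> < 0) \<and>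
     C2_on {..<a} f \<and> C2_on {a<..} f \<and>
     (\<forall>\<eta><a. ((\<lambda>x. deriv \<phi> (f x) * deriv f x)
                has_real_derivative (- (1/2) * \<eta> * deriv f \<eta>)) (at \<eta>)) \<and>
     (\<forall>\<eta>>a. ((\<lambda>x. \<epsilon> * deriv \<phi> (- f x) * deriv f x)
                has_real_derivative (- (1/2) * \<eta> * deriv f \<eta>)) (at \<eta>)) \<and>
     (f \<longlongrightarrow> U\<^sub>0) at_bot \<and> (f \<longlongrightarrow> - V\<^sub>0) at_top \<and>
     (f \<longlongrightarrow> 0) (at_left a) \<and> (f \<longlongrightarrow> 0) (at_right a) \<and>
     (\<exists>l r. ((\<lambda>\<eta>. deriv \<phi> (f \<eta>) * deriv f \<eta>) \<longlongrightarrow> l) (at_left a) \<and>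
            ((\<lambda>\<eta>. deriv \<phi> (- f \<eta>) * deriv f \<eta>) \<longlongrightarrow> r) (at_right a) \<and>
            l = \<epsilon> * r)"

end

theory Submission
  imports Defs
begin

text \<open>
  Along a solution the flux is negative, so \<open>f\<close> decreases and \<open>h u = - flux\<close> may be regarded as a
  function of the value \<open>u = f \<eta>\<close>. Both differential equations then say \<open>\<eta> = 2 * h' u\<close> and
  \<open>h'' = - r / h\<close>, where \<open>r u\<close> is half of \<open>\<phi>' u\<close> (for \<open>u > 0\<close>) or of \<open>\<epsilon> * \<phi>' (- u)\<close> (for
  \<open>u < 0\<close>). The conditions at the free boundary become \<open>C\<^sup>1\<close> regularity of \<open>h\<close> at \<open>0\<close> (with
  \<open>a = 2 * h' 0\<close>), and those at infinity become \<open>h = 0\<close> at \<open>- V\<^sub>0\<close> and \<open>U\<^sub>0\<close>.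

  This singular Dirichlet problem has at most one positive solution because the square of the
  difference of two solutions is convex. With boundary value \<open>\<delta> > 0\<close> instead of \<open>0\<close>, the function
  \<open>ln h\<close> is the fixed point of a contraction; by the same convexity the solutions converge
  uniformly as \<open>\<delta>\<close> tends to \<open>0\<close>. Conversely \<open>f\<close> is recovered as the inverse of \<open>2 * h'\<close>, which
  maps onto the real line since \<open>h'\<close> diverges at both ends.
\<close>

subsection \<open>A singular boundary value problem\<close>

text \<open>The mean value theorem on both sides of \<open>x\<close> yields slopes at some
  \<open>c < x < d\<close>, and the gap to the chord is \<open>(B - x) * (x - A)\<close> times their
  difference. Only monotonicity of \<open>p'\<close> enters, so the lemma also serves functions
  whose second derivative is missing at a point.\<close>

lemma above_chord:
  fixes p p' :: "real \<Rightarrow> real"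
  assumes "continuous_on {A..B} p"
    and der: "\<And>x. A < x \<Longrightarrow> x < B \<Longrightarrow> (p has_real_derivative p' x) (at x)"
    and anti: "\<And>x y. A < x \<Longrightarrow> x < y \<Longrightarrow> y < B \<Longrightarrow> p' y \<le> p' x"
    and x: "A < x" "x < B"
  shows "(B - x) * p A + (x - A) * p B \<le> (B - A) * p x"
    and "(\<And>x y. A < x \<Longrightarrow> x < y \<Longrightarrow> y < B \<Longrightarrow> p' y < p' x) \<Longrightarrow>
      (B - x) * p A + (x - A) * p B < (B - A) * p x"
proof -
  have "\<exists>c>A. c < x \<and> p x - p A = p' c * (x - A)"
  proof -
    have "continuous_on {A..x} p"
      using assms(1) x by (auto intro: continuous_on_subset)
    then obtain c where "A < c" "c < x" "p x - p A = (\<lambda>t. p' c * t) (x - A)"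
      using mvt[of A x p "\<lambda>y t. p' y * t"] der x
      by (metis has_field_derivative_def less_trans)
    then show ?thesis by auto
  qed
  then obtain c where c: "A < c" "c < x" "p x - p A = p' c * (x - A)" by auto
  have "\<exists>c>x. c < B \<and> p B - p x = p' c * (B - x)"
  proof -
    have "continuous_on {x..B} p"
      using assms(1) x by (auto intro: continuous_on_subset)
    then obtain c where "x < c" "c < B" "p B - p x = (\<lambda>t. p' c * t) (B - x)"
      using mvt[of x B p "\<lambda>y t. p' y * t"] der x
      by (metis has_field_derivative_def less_trans)
    then show ?thesis by auto
  qed
  then obtain d where d: "x < d" "d < B" "p B - p x = p' d * (B - x)" by auto
  have "(B - A) * p x - ((B - x) * p A + (x - A) * p B)
      = (B - x) * (p x - p A) - (x - A) * (p B - p x)"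
    by (simp add: algebra_simps)
  also have "\<dots> = (B - x) * (x - A) * (p' c - p' d)"
    by (simp add: c(3) d(3) algebra_simps)
  finally have eq: "(B - A) * p x - ((B - x) * p A + (x - A) * p B)
      = (B - x) * (x - A) * (p' c - p' d)" .
  have "0 \<le> (B - x) * (x - A) * (p' c - p' d)"
    using x anti[of c d] c d by (intro mult_nonneg_nonneg) auto
  then show "(B - x) * p A + (x - A) * p B \<le> (B - A) * p x"
    using eq by linarith
  assume strict: "\<And>x y. A < x \<Longrightarrow> x < y \<Longrightarrow> y < B \<Longrightarrow> p' y < p' x"
  have "0 < (B - x) * (x - A) * (p' c - p' d)"
    using x strict[of c d] c d by (intro mult_pos_pos) auto
  then show "(B - x) * p A + (x - A) * p B < (B - A) * p x"
    using eq by linarith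
qed

text \<open>One-dimensional minimum principle: a concave function lies above its chord, and the
  chord is nonnegative.\<close>

lemma nonneg_of_second_derivative_nonpos:
  fixes p p' p'' :: "real \<Rightarrow> real"
  assumes "continuous_on {A..B} p" "0 \<le> p A" "0 \<le> p B"
    and der: "\<And>x. A < x \<Longrightarrow> x < B \<Longrightarrow> (p has_real_derivative p' x) (at x)"
    and der2: "\<And>x. A < x \<Longrightarrow> x < B \<Longrightarrow> (p' has_real_derivative p'' x) (at x)"
    and np: "\<And>x. A < x \<Longrightarrow> x < B \<Longrightarrow> p'' x \<le> 0"
    and x: "A \<le> x" "x \<le> B"
  shows "0 \<le> p x"
proof (cases "x = A \<or> x = B")
  case False
  then have x': "A < x" "x < B" using x by auto
  have "p' y \<le> p' x" if "A < x" "x < y" "y < B" for x y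
  proof (rule DERIV_nonpos_imp_nonincreasing[of x y p'])
    fix t assume "x \<le> t" "t \<le> y"
    then have "A < t" "t < B" using that by auto
    then show "\<exists>y. (p' has_real_derivative y) (at t) \<and> y \<le> 0"
      using der2 np by blast
  qed (use that in auto)
  then have "(B - x) * p A + (x - A) * p B \<le> (B - A) * p x"
    by (intro above_chord(1)[where p' = p'] assms x')
  moreover have "0 \<le> (B - x) * p A + (x - A) * p B"
    using assms x' by (intro add_nonneg_nonneg mult_nonneg_nonneg) auto
  ultimately have "0 \<le> (B - A) * p x" by linarith
  then show ?thesis using x' by (simp add: zero_le_mult_iff)
qed (use assms in auto)

text \<open>Continuity glues the monotone pieces on the two sides of \<open>z\<close>. The
  exceptional point stands for the value \<open>0\<close> or the position \<open>a\<close> of the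
  free boundary, where derivatives may vanish or be unknown.\<close>

lemma increasing_off_point:
  fixes f f' :: "real \<Rightarrow> real"
  assumes cont: "continuous_on {A<..<B} f"
    and der: "\<And>x. A < x \<Longrightarrow> x < B \<Longrightarrow> x \<noteq> z \<Longrightarrow> (f has_real_derivative f' x) (at x)"
    and nn: "\<And>x. A < x \<Longrightarrow> x < B \<Longrightarrow> x \<noteq> z \<Longrightarrow> 0 \<le> f' x"
    and xy: "A < x" "x < y" "y < B"
  shows "f x \<le> f y"
    and "(\<And>x. A < x \<Longrightarrow> x < B \<Longrightarrow> x \<noteq> z \<Longrightarrow> 0 < f' x) \<Longrightarrow> f x < f y"
proof -
  have cont': "continuous_on {u..v} f" if "A < u" "v < B" for u v
    using cont that by (auto intro: continuous_on_subset)
  have le: "f u \<le> f v" if "A < u" "u \<le> v" "v < B" "z \<le> u \<or> v \<le> z" for u v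
  proof (rule DERIV_nonneg_imp_increasing_open[OF that(2)])
    fix t assume "u < t" "t < v"
    then have "A < t" "t < B" "t \<noteq> z" using that by auto
    then show "\<exists>y. (f has_real_derivative y) (at t) \<and> 0 \<le> y"
      using der nn by blast
  qed (use that cont' in auto)
  show "f x \<le> f y"
  proof (cases "z \<le> x \<or> y \<le> z")
    case True then show ?thesis using le[of x y] xy by auto
  next
    case False then show ?thesis using le[of x z] le[of z y] xy by auto
  qed
  assume pos: "\<And>x. A < x \<Longrightarrow> x < B \<Longrightarrow> x \<noteq> z \<Longrightarrow> 0 < f' x"
  have less: "f u < f v" if "A < u" "u < v" "v < B" "z \<le> u \<or> v \<le> z" for u v
  proof (rule DERIV_pos_imp_increasing_open[OF that(2)])
    fix t assume "u < t" "t < v"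
    then have "A < t" "t < B" "t \<noteq> z" using that by auto
    then show "\<exists>y. (f has_real_derivative y) (at t) \<and> 0 < y"
      using der pos by blast
  qed (use that cont' in auto)
  show "f x < f y"
  proof (cases "z \<le> x \<or> y \<le> z")
    case True then show ?thesis using less[of x y] xy by auto
  next
    case False then show ?thesis using less[of x z] less[of z y] xy by auto
  qed
qed

section \<open>Linear Dirichlet problem, comparison and stability\<close>

text \<open>Integrating \<open>r\<close> twice solves the equation up to an affine function; the
  slope \<open>k\<close> is the one that meets the boundary value at \<open>B\<close>.\<close>

lemma dirichlet_solution:
  fixes r :: "real \<Rightarrow> real"
  assumes "A < B" "continuous_on {A..B} r"
  obtains h h' where "continuous_on {A..B} h" "h A = \<alpha>" "h B = \<beta>"
    "\<And>x. A < x \<Longrightarrow> x < B \<Longrightarrow> (h has_real_derivative h' x) (at x)"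
    "\<And>x. A < x \<Longrightarrow> x < B \<Longrightarrow> (h' has_real_derivative - r x) (at x)"
proof -
  obtain R where R: "\<And>x. x \<in> {A..B} \<Longrightarrow> (R has_real_derivative r x) (at x within {A..B})"
    using antiderivative_continuous[OF assms(2)]
    by (auto simp: has_real_derivative_iff_has_vector_derivative)
  then have "continuous_on {A..B} R"
    by (meson DERIV_continuous continuous_on_eq_continuous_within)
  then obtain S where S: "\<And>x. x \<in> {A..B} \<Longrightarrow> (S has_real_derivative R x) (at x within {A..B})"
    using antiderivative_continuous[of A B R]
    by (auto simp: has_real_derivative_iff_has_vector_derivative)
  then have contS: "continuous_on {A..B} S"
    by (meson DERIV_continuous continuous_on_eq_continuous_within)
  have at: "at x within {A..B} = at x" if "A < x" "x < B" for x
    using that by (intro at_within_interior) auto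
  define k where "k = (\<beta> - \<alpha> + S B - S A) / (B - A)"
  define h where "h x = \<alpha> + k * (x - A) - (S x - S A)" for x
  have "continuous_on {A..B} h"
    unfolding h_def by (intro continuous_intros contS)
  moreover have "h A = \<alpha>" "h B = \<beta>"
    using assms(1) by (auto simp: h_def k_def)
  moreover have "(h has_real_derivative k - R x) (at x)"
      "((\<lambda>x. k - R x) has_real_derivative - r x) (at x)" if "A < x" "x < B" for x
    using S[of x] R[of x] that unfolding h_def at[OF that]
    by (auto intro!: derivative_eq_intros)
  ultimately show thesis by (rule that)
qed

text \<open>The square of the difference is convex, because the nonlinearity \<open>- r / h\<close> increases with \<open>h\<close>.\<close>

lemma singular_bvp_comparison:
  fixes r h\<^sub>1 h\<^sub>2 p\<^sub>1 p\<^sub>2 :: "real \<Rightarrow> real"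
  assumes cont: "continuous_on {A..B} h\<^sub>1" "continuous_on {A..B} h\<^sub>2"
    and cont': "continuous_on {A<..<B} p\<^sub>1" "continuous_on {A<..<B} p\<^sub>2"
    and der: "\<And>x. A < x \<Longrightarrow> x < B \<Longrightarrow> (h\<^sub>1 has_real_derivative p\<^sub>1 x) (at x)"
      "\<And>x. A < x \<Longrightarrow> x < B \<Longrightarrow> (h\<^sub>2 has_real_derivative p\<^sub>2 x) (at x)"
    and der2: "\<And>x. A < x \<Longrightarrow> x < B \<Longrightarrow> x \<noteq> z \<Longrightarrow> (p\<^sub>1 has_real_derivative - r x / h\<^sub>1 x) (at x)"
      "\<And>x. A < x \<Longrightarrow> x < B \<Longrightarrow> x \<noteq> z \<Longrightarrow> (p\<^sub>2 has_real_derivative - r x / h\<^sub>2 x) (at x)"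
    and pos: "\<And>x. A < x \<Longrightarrow> x < B \<Longrightarrow> x \<noteq> z \<Longrightarrow> 0 < h\<^sub>1 x"
      "\<And>x. A < x \<Longrightarrow> x < B \<Longrightarrow> x \<noteq> z \<Longrightarrow> 0 < h\<^sub>2 x"
    and r: "\<And>x. 0 \<le> r x"
    and bd: "\<bar>h\<^sub>1 A - h\<^sub>2 A\<bar> \<le> e" "\<bar>h\<^sub>1 B - h\<^sub>2 B\<bar> \<le> e"
    and x: "A \<le> x" "x \<le> B"
  shows "\<bar>h\<^sub>1 x - h\<^sub>2 x\<bar> \<le> e"
proof (cases "x = A \<or> x = B")
  case False
  then have x': "A < x" "x < B" using x by auto
  define d where "d x = h\<^sub>1 x - h\<^sub>2 x" for x
  define q where "q x = p\<^sub>1 x - p\<^sub>2 x" for x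
  have d_der: "(d has_real_derivative q x) (at x)" if "A < x" "x < B" for x
    unfolding d_def q_def using der that by (auto intro!: derivative_eq_intros)
  have dq_mono: "d u * q u \<le> d v * q v" if uv: "A < u" "u < v" "v < B" for u v
  proof (rule increasing_off_point(1)[OF _ _ _ uv, of "\<lambda>x. d x * q x" z
        "\<lambda>x. (q x)\<^sup>2 + d x * (r x / h\<^sub>2 x - r x / h\<^sub>1 x)"])
    have "continuous_on {A<..<B} h\<^sub>1" "continuous_on {A<..<B} h\<^sub>2"
      by (rule continuous_on_subset[OF cont(1)] continuous_on_subset[OF cont(2)]; auto)+
    then show "continuous_on {A<..<B} (\<lambda>x. d x * q x)"
      unfolding d_def q_def by (intro continuous_intros cont')
  next
    fix x assume xx: "A < x" "x < B" "x \<noteq> z"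
    have "(q has_real_derivative r x / h\<^sub>2 x - r x / h\<^sub>1 x) (at x)"
      unfolding q_def using der2[OF xx] by (auto intro!: derivative_eq_intros)
    then show "((\<lambda>x. d x * q x) has_real_derivative
        (q x)\<^sup>2 + d x * (r x / h\<^sub>2 x - r x / h\<^sub>1 x)) (at x)"
      using d_der[OF xx(1,2)]
      by (auto intro!: derivative_eq_intros simp: power2_eq_square)
    have "r x / h\<^sub>2 x - r x / h\<^sub>1 x = r x * d x / (h\<^sub>1 x * h\<^sub>2 x)"
      using pos[OF xx] by (simp add: d_def field_simps)
    then have "d x * (r x / h\<^sub>2 x - r x / h\<^sub>1 x) = r x * (d x)\<^sup>2 / (h\<^sub>1 x * h\<^sub>2 x)"
      by (simp add: power2_eq_square)
    then show "0 \<le> (q x)\<^sup>2 + d x * (r x / h\<^sub>2 x - r x / h\<^sub>1 x)"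
      using pos[OF xx] r[of x] by simp
  qed
  \<comment> \<open>The concave function \<open>e\<^sup>2 - d\<^sup>2\<close> lies above its chord,
    and both boundary bounds make that chord nonnegative.\<close>
  have "(B - x) * (e\<^sup>2 - (d A)\<^sup>2) + (x - A) * (e\<^sup>2 - (d B)\<^sup>2) \<le> (B - A) * (e\<^sup>2 - (d x)\<^sup>2)"
  proof (rule above_chord(1)[where p' = "\<lambda>x. - 2 * (d x * q x)"])
    show "continuous_on {A..B} (\<lambda>x. e\<^sup>2 - (d x)\<^sup>2)"
      unfolding d_def by (intro continuous_intros cont)
    show "((\<lambda>x. e\<^sup>2 - (d x)\<^sup>2) has_real_derivative - 2 * (d x * q x)) (at x)"
      if "A < x" "x < B" for x
      using d_der[OF that] by (auto intro!: derivative_eq_intros)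
  qed (use dq_mono x' in auto)
  moreover have "0 \<le> e" using bd by linarith
  then have "(d A)\<^sup>2 \<le> e\<^sup>2" "(d B)\<^sup>2 \<le> e\<^sup>2"
    using bd by (auto simp: d_def abs_le_square_iff[symmetric])
  then have "0 \<le> (B - x) * (e\<^sup>2 - (d A)\<^sup>2) + (x - A) * (e\<^sup>2 - (d B)\<^sup>2)"
    using x' by (intro add_nonneg_nonneg mult_nonneg_nonneg) auto
  ultimately have "0 \<le> (B - A) * (e\<^sup>2 - (d x)\<^sup>2)" by linarith
  then have "(d x)\<^sup>2 \<le> e\<^sup>2" using x' by (simp add: zero_le_mult_iff)
  then show ?thesis using \<open>0 \<le> e\<close> by (simp add: d_def abs_le_square_iff[symmetric])
qed (use bd in auto)

text \<open>The barrier \<open>b + e * ((x - A) * (B - x))\<close> has second derivative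
  \<open>- 2 * e\<close>, so adding \<open>p\<close> or \<open>- p\<close> leaves it concave and
  nonnegative at both ends.\<close>

lemma second_order_stability:
  fixes p p' p'' :: "real \<Rightarrow> real"
  assumes cont: "continuous_on {A..B} p"
    and der: "\<And>x. A < x \<Longrightarrow> x < B \<Longrightarrow> (p has_real_derivative p' x) (at x)"
    and der2: "\<And>x. A < x \<Longrightarrow> x < B \<Longrightarrow> (p' has_real_derivative p'' x) (at x)"
    and le: "\<And>x. A < x \<Longrightarrow> x < B \<Longrightarrow> \<bar>p'' x\<bar> \<le> 2 * e"
    and bd: "\<bar>p A\<bar> \<le> b" "\<bar>p B\<bar> \<le> b"
    and x: "A \<le> x" "x \<le> B"
  shows "\<bar>p x\<bar> \<le> b + e * ((x - A) * (B - x))"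
proof -
  have "0 \<le> b + e * ((x - A) * (B - x)) + s * p x" if s: "s = 1 \<or> s = -1" for s
  proof (rule nonneg_of_second_derivative_nonpos[where A=A and B=B and x=x
        and p = "\<lambda>x. b + e * ((x - A) * (B - x)) + s * p x"
        and p' = "\<lambda>x. e * (A + B - 2 * x) + s * p' x"
        and p'' = "\<lambda>x. - 2 * e + s * p'' x"])
    show "continuous_on {A..B} (\<lambda>x. b + e * ((x - A) * (B - x)) + s * p x)"
      by (intro continuous_intros cont)
    fix x assume xx: "A < x" "x < B"
    show "((\<lambda>x. b + e * ((x - A) * (B - x)) + s * p x) has_real_derivative
        e * (A + B - 2 * x) + s * p' x) (at x)"
      using der[OF xx] by (auto intro!: derivative_eq_intros simp: algebra_simps)
    show "((\<lambda>x. e * (A + B - 2 * x) + s * p' x) has_real_derivative - 2 * e + s * p'' x) (at x)"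
      using der2[OF xx] by (auto intro!: derivative_eq_intros)
    show "- 2 * e + s * p'' x \<le> 0" using le[OF xx] s by auto
  qed (use s bd x in auto)
  from this[of 1] this[of "-1"] show ?thesis by auto
qed

section \<open>The problem with boundary value \<delta>\<close>

text \<open>
  Solving \<open>X'' = - r / h\<close> with zero boundary values is only nonexpansive in \<open>h\<close> for the distance
  \<open>sup \<bar>ln h\<^sub>1 - ln h\<^sub>2\<bar>\<close>; adding the boundary value \<open>\<delta>\<close> to \<open>X \<le> M\<close> gives the factor
  \<open>M / (\<delta> + M) < 1\<close>.
\<close>

lemma ln_shift_contraction:
  fixes \<delta> M t :: real
  assumes "0 < \<delta>" "0 < M" "0 \<le> x" "x \<le> M" "0 \<le> y" "y \<le> M"
    and xy: "x \<le> exp t * y" "y \<le> exp t * x" and "0 \<le> t"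
  shows "\<bar>ln (\<delta> + x) - ln (\<delta> + y)\<bar> \<le> M / (\<delta> + M) * t"
proof -
  have main: "ln (\<delta> + v) - ln (\<delta> + u) \<le> M / (\<delta> + M) * t"
    if u: "0 < u" "u \<le> v" "v \<le> M" "v \<le> exp t * u" for u v
  proof -
    define \<theta> where "\<theta> = M / (\<delta> + M)"
    have \<theta>: "0 \<le> \<theta>" using assms by (simp add: \<theta>_def)
    \<comment> \<open>Since \<open>\<theta> / s >= 1 / (\<delta> + s)\<close> exactly when
      \<open>s <= M\<close>, the increment of \<open>ln (\<delta> + s)\<close> is at most \<theta>
      times that of \<open>ln s\<close>.\<close>
    have "\<theta> * ln u - ln (\<delta> + u) \<le> \<theta> * ln v - ln (\<delta> + v)"
    proof (rule DERIV_nonneg_imp_nondecreasing[OF u(2)])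
      fix s assume s: "u \<le> s" "s \<le> v"
      then have "0 < s" using u by linarith
      then have "((\<lambda>s. \<theta> * ln s - ln (\<delta> + s)) has_real_derivative \<theta> / s - 1 / (\<delta> + s)) (at s)"
        using assms(1) by (auto intro!: derivative_eq_intros)
      moreover have "0 \<le> \<theta> / s - 1 / (\<delta> + s)"
      proof -
        have "1 / (\<delta> + s) \<le> \<theta> / s \<longleftrightarrow> s * (\<delta> + M) \<le> M * (\<delta> + s)"
          using \<open>0 < s\<close> assms(1,2) by (simp add: \<theta>_def divide_simps mult.commute)
        moreover have "s * (\<delta> + M) \<le> M * (\<delta> + s)"
          using s u(3) assms(1) mult_left_mono[of s M \<delta>] by (simp add: algebra_simps)
        ultimately show ?thesis by simp
      qed
      ultimately show "\<exists>y. ((\<lambda>s. \<theta> * ln s - ln (\<delta> + s)) has_real_derivative y) (at s) \<and> 0 \<le> y"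
        by blast
    qed
    moreover have "ln v \<le> t + ln u"
      using u ln_mono[of v "exp t * u"] by (simp add: ln_mult)
    then have "\<theta> * (ln v - ln u) \<le> \<theta> * t" using \<theta> by (intro mult_left_mono) auto
    ultimately show ?thesis by (simp add: \<theta>_def[symmetric] right_diff_distrib)
  qed
  show ?thesis
  proof (cases "x = 0 \<or> y = 0")
    \<comment> \<open>By \<open>xy\<close>, if one of \<open>x\<close> and \<open>y\<close> vanishes
      then so does the other; this separates the case in which logarithms of \<open>x\<close> and
      \<open>y\<close> cannot be used.\<close>
    case True
    then have x0: "x = 0" "y = 0" using assms by auto
    then show ?thesis using assms by simp
  next
    case False
    then show ?thesis
      using main[of x y] main[of y x] assms by (cases "x \<le> y") auto
  qed
qed

text \<open>The unknown is \<open>g = ln h\<close>. Let \<open>X g\<close> solve the linear problem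
  with source \<open>r * exp (- g)\<close> and zero boundary values; a fixed point of
  \<open>g \<mapsto> ln (\<delta> + X g)\<close> then gives \<open>h = \<delta> + X g\<close>, and
  Banach's theorem applies in the sup norm.\<close>

lemma regularised_bvp:
  fixes r :: "real \<Rightarrow> real"
  assumes "A < B" "0 < \<delta>" and r: "continuous_on {A..B} r" "\<And>x. 0 \<le> r x"
  shows "\<exists>h h'. continuous_on {A..B} h \<and> h A = \<delta> \<and> h B = \<delta> \<and>
    (\<forall>x. A < x \<longrightarrow> x < B \<longrightarrow> \<delta> \<le> h x \<and> (h has_real_derivative h' x) (at x) \<and>
       (h' has_real_derivative - r x / h x) (at x))"
proof -
  have "\<exists>h h'. continuous_on {A..B} h \<and> h A = 0 \<and> h B = 0 \<and>
    (\<forall>x. A < x \<longrightarrow> x < B \<longrightarrow> (h has_real_derivative h' x) (at x) \<and>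
       (h' has_real_derivative - (r x * exp (- g x))) (at x))" for g :: "real \<Rightarrow>\<^sub>C real"
  proof -
    have "continuous_on {A..B} (\<lambda>x. r x * exp (- g x))"
      by (intro continuous_intros r(1) continuous_on_apply_bcontfun)
    from dirichlet_solution[OF assms(1) this, of 0 0] show ?thesis
      by (smt (verit, del_insts))
  qed
  then obtain X X' :: "(real \<Rightarrow>\<^sub>C real) \<Rightarrow> real \<Rightarrow> real"
    where X_cont: "\<And>g. continuous_on {A..B} (X g)"
    and X_bd: "\<And>g. X g A = 0" "\<And>g. X g B = 0"
    and X_der: "\<And>g x. A < x \<Longrightarrow> x < B \<Longrightarrow> (X g has_real_derivative X' g x) (at x)"
      "\<And>g x. A < x \<Longrightarrow> x < B \<Longrightarrow> (X' g has_real_derivative - (r x * exp (- g x))) (at x)"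
    by metis
  \<comment> \<open>Linearity and the minimum principle: an inequality between the sources passes to
    the solutions.\<close>
  have X_le: "X g\<^sub>1 x \<le> c * X g\<^sub>2 x"
    if le: "\<And>x. exp (- g\<^sub>1 x) \<le> c * exp (- g\<^sub>2 x)" and x: "A \<le> x" "x \<le> B"
    for g\<^sub>1 g\<^sub>2 :: "real \<Rightarrow>\<^sub>C real" and c x
  proof -
    have "0 \<le> c * X g\<^sub>2 x - X g\<^sub>1 x"
    proof (rule nonneg_of_second_derivative_nonpos[where p = "\<lambda>x. c * X g\<^sub>2 x - X g\<^sub>1 x"
          and p' = "\<lambda>x. c * X' g\<^sub>2 x - X' g\<^sub>1 x"
          and p'' = "\<lambda>x. r x * (exp (- g\<^sub>1 x) - c * exp (- g\<^sub>2 x))", OF _ _ _ _ _ _ x])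
      show "continuous_on {A..B} (\<lambda>x. c * X g\<^sub>2 x - X g\<^sub>1 x)"
        by (intro continuous_intros X_cont)
      fix x assume xx: "A < x" "x < B"
      show "((\<lambda>x. c * X g\<^sub>2 x - X g\<^sub>1 x) has_real_derivative c * X' g\<^sub>2 x - X' g\<^sub>1 x) (at x)"
        by (auto intro!: derivative_eq_intros X_der xx)
      show "((\<lambda>x. c * X' g\<^sub>2 x - X' g\<^sub>1 x) has_real_derivative
          r x * (exp (- g\<^sub>1 x) - c * exp (- g\<^sub>2 x))) (at x)"
        by (rule derivative_eq_intros X_der xx refl)+ (simp add: algebra_simps)
      show "r x * (exp (- g\<^sub>1 x) - c * exp (- g\<^sub>2 x)) \<le> 0"
        using le[of x] r(2)[of x] by (simp add: mult_nonneg_nonpos)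
    qed (simp_all add: X_bd)
    then show ?thesis by simp
  qed
  have X_nonneg: "0 \<le> X g x" if "A \<le> x" "x \<le> B" for g x
    using nonneg_of_second_derivative_nonpos[OF X_cont _ _ X_der(1) X_der(2) _ that, of g] X_bd r(2)
    by simp
  have "bounded (X 0 ` {A..B})"
    by (intro compact_imp_bounded compact_continuous_image X_cont) auto
  then obtain K where K: "\<And>x. A \<le> x \<Longrightarrow> x \<le> B \<Longrightarrow> X 0 x \<le> K" "0 < K"
    unfolding bounded_pos by (fastforce simp: abs_le_iff)
  \<comment> \<open>\<open>K\<close> bounds \<open>X 0\<close>, the solution with source
    \<open>r\<close>. For \<open>g >= ln \<delta>\<close> the source is at most
    \<open>r / \<delta>\<close>, which makes \<open>M\<close> a bound uniform in
    \<open>g\<close>.\<close>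
  define M where "M = K / \<delta>"
  have M: "0 < M" using K(2) assms(2) by (simp add: M_def)
  have X_le_M: "X g x \<le> M" if "\<And>x. ln \<delta> \<le> g x" "A \<le> x" "x \<le> B" for g :: "real \<Rightarrow>\<^sub>C real" and x
  proof -
    have "exp (- g x) \<le> 1 / \<delta> * exp (- (0 :: real \<Rightarrow>\<^sub>C real) x)" for x
    proof -
      have "exp (- g x) \<le> exp (- ln \<delta>)" using that(1)[of x] by simp
      then show ?thesis using assms(2) by (simp add: exp_minus field_simps)
    qed
    then have "X g x \<le> 1 / \<delta> * X 0 x" by (rule X_le) (use that in auto)
    also have "\<dots> \<le> M" using K(1)[OF that(2,3)] assms(2) by (simp add: M_def field_simps)
    finally show ?thesis .
  qed
  \<comment> \<open>\<open>clamp\<close> extends the function from \<open>{A..B}\<close> to the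
    whole line by constants, so that the iteration takes place in the complete space of bounded
    continuous functions.\<close>
  have "\<exists>G :: real \<Rightarrow>\<^sub>C real. \<forall>x. G x = ln (\<delta> + X g (clamp A B x))" for g
  proof -
    have "continuous_on (cbox A B) (\<lambda>x. ln (\<delta> + X g x))"
    proof (rule continuous_on_ln)
      show "continuous_on (cbox A B) (\<lambda>x. \<delta> + X g x)"
        unfolding cbox_interval by (intro continuous_intros X_cont)
      show "\<forall>x\<in>cbox A B. \<delta> + X g x \<noteq> 0"
      proof
        fix x assume "x \<in> cbox A B"
        then have "0 \<le> X g x" by (intro X_nonneg) (auto simp: cbox_interval)
        then show "\<delta> + X g x \<noteq> 0" using assms(2) by linarith
      qed
    qed
    then show ?thesis
      by (rule continuous_on_cbox_bcontfunE) blast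
  qed
  then obtain G :: "(real \<Rightarrow>\<^sub>C real) \<Rightarrow> (real \<Rightarrow>\<^sub>C real)"
    where G: "\<And>g x. G g x = ln (\<delta> + X g (clamp A B x))"
    by metis
  have cl: "A \<le> clamp A B x" "clamp A B x \<le> B" for x
    using clamp_in_interval[of A B x] assms(1) by (auto simp: cbox_interval)
  define S where "S = {g :: real \<Rightarrow>\<^sub>C real. \<forall>x. ln \<delta> \<le> g x}"
  have "\<exists>!g\<in>S. G g = g"
  proof (rule Banach_fix)
    have "S = PiC UNIV (\<lambda>_. {ln \<delta>..})"
      by (auto simp: S_def mem_PiC_iff Pi_iff)
    then show "complete S" by (simp add: closed_PiC complete_eq_closed)
    show "S \<noteq> {}"
      by (auto simp: S_def intro!: exI[of _ "const_bcontfun (ln \<delta>)"])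
    show "0 \<le> M / (\<delta> + M)" "M / (\<delta> + M) < 1"
      using M assms(2) by auto
    have "ln \<delta> \<le> ln (\<delta> + X g (clamp A B x))" for g x
      using X_nonneg[OF cl, of g x] assms(2) by simp
    then show "G ` S \<subseteq> S" by (auto simp: S_def G)
    show "dist (G g\<^sub>1) (G g\<^sub>2) \<le> M / (\<delta> + M) * dist g\<^sub>1 g\<^sub>2" if g: "g\<^sub>1 \<in> S" "g\<^sub>2 \<in> S" for g\<^sub>1 g\<^sub>2
    proof (rule dist_bound)
      fix x
      \<comment> \<open>Functions at sup distance \<open>t\<close> have sources within a factor
        \<open>exp t\<close> of each other, in either order; \<open>X_le\<close> carries this factor
        over to the solutions, as the contraction estimate requires.\<close>
      have le: "exp (- u y) \<le> exp (dist g\<^sub>1 g\<^sub>2) * exp (- v y)"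
        if "u = g\<^sub>1 \<and> v = g\<^sub>2 \<or> u = g\<^sub>2 \<and> v = g\<^sub>1" for u v y
        using dist_bounded[of g\<^sub>1 y g\<^sub>2] that by (auto simp: exp_add[symmetric] dist_real_def)
      have "\<bar>ln (\<delta> + X g\<^sub>1 (clamp A B x)) - ln (\<delta> + X g\<^sub>2 (clamp A B x))\<bar>
          \<le> M / (\<delta> + M) * dist g\<^sub>1 g\<^sub>2"
        using g by (intro ln_shift_contraction assms M X_nonneg X_le_M X_le cl le zero_le_dist)
          (auto simp: S_def)
      then show "dist (G g\<^sub>1 x) (G g\<^sub>2 x) \<le> M / (\<delta> + M) * dist g\<^sub>1 g\<^sub>2"
        by (simp add: G dist_real_def)
    qed
  qed
  then obtain g where g: "g \<in> S" "G g = g" by blast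
  \<comment> \<open>At the fixed point \<open>exp (- g)\<close> equals \<open>1 / h\<close>, which
    turns the linear source into the singular one.\<close>
  have eq: "exp (g x) = \<delta> + X g x" if "A \<le> x" "x \<le> B" for x
  proof -
    have "clamp A B x = x" using that by (intro clamp_cancel_cbox) (auto simp: cbox_interval)
    then have "g x = ln (\<delta> + X g x)" using G[of g x] g(2) by simp
    then show ?thesis using X_nonneg[OF that, of g] assms(2) by simp
  qed
  show ?thesis
  proof (rule exI[of _ "\<lambda>x. \<delta> + X g x"], rule exI[of _ "X' g"], intro conjI allI impI)
    show "continuous_on {A..B} (\<lambda>x. \<delta> + X g x)" by (intro continuous_intros X_cont)
    fix x assume x: "A < x" "x < B"
    show "\<delta> \<le> \<delta> + X g x" using X_nonneg[of x g] x by simp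
    show "((\<lambda>x. \<delta> + X g x) has_real_derivative X' g x) (at x)"
      using X_der(1)[OF x] by (auto intro!: derivative_eq_intros)
    have "- r x / (\<delta> + X g x) = - (r x * exp (- g x))"
      using eq[of x] x by (simp add: exp_minus field_simps)
    then show "(X' g has_real_derivative - r x / (\<delta> + X g x)) (at x)"
      using X_der(2)[OF x] by simp
  qed (simp_all add: X_bd)
qed

section \<open>Passage to zero boundary values\<close>

text \<open>The solutions \<open>h n\<close> with boundary values \<open>\<delta> n\<close> differ
  by at most \<open>\<bar>\<delta> n - \<delta> m\<bar>\<close>, so they converge uniformly. A lower
  barrier independent of \<open>n\<close> keeps the limit positive, and stability of the linear
  problem on compact subintervals shows that the limit solves the equation.\<close>

theorem singular_bvp_exists:
  fixes r :: "real \<Rightarrow> real"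
  assumes "A < B" and r: "continuous_on {A..B} r" "\<And>x. 0 \<le> r x" "\<And>x. x \<noteq> z \<Longrightarrow> 0 < r x"
  shows "\<exists>h h'. continuous_on {A..B} h \<and> h A = 0 \<and> h B = 0 \<and>
    (\<forall>x. A < x \<longrightarrow> x < B \<longrightarrow> 0 < h x \<and> (h has_real_derivative h' x) (at x) \<and>
       (h' has_real_derivative - r x / h x) (at x))"
proof -
  define \<delta> where "\<delta> n = inverse (real (Suc n))" for n
  have \<delta>: "0 < \<delta> n" "\<delta> n \<le> 1" for n by (auto simp: \<delta>_def inverse_eq_divide)
  have \<delta>_lim: "\<delta> \<longlonglongrightarrow> 0" unfolding \<delta>_def by (rule LIMSEQ_inverse_real_of_nat)
  obtain h h' where h_cont: "\<And>n. continuous_on {A..B} (h n)"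
    and h_bd: "\<And>n. h n A = \<delta> n" "\<And>n. h n B = \<delta> n"
    and h_ge: "\<And>n x. A < x \<Longrightarrow> x < B \<Longrightarrow> \<delta> n \<le> h n x"
    and h_der: "\<And>n x. A < x \<Longrightarrow> x < B \<Longrightarrow> (h n has_real_derivative h' n x) (at x)"
      "\<And>n x. A < x \<Longrightarrow> x < B \<Longrightarrow> (h' n has_real_derivative - r x / h n x) (at x)"
    using regularised_bvp[OF assms(1) \<delta>(1) r(1,2)] by metis
  have h_pos: "0 < h n x" if "A < x" "x < B" for n x
    using h_ge[OF that, of n] \<delta>(1)[of n] by linarith
  have h'_cont: "continuous_on {A<..<B} (h' n)" for n
    by (intro continuous_at_imp_continuous_on ballI DERIV_isCont[OF h_der(2)]) auto
  have h_diff: "\<bar>h n x - h m x\<bar> \<le> \<bar>\<delta> n - \<delta> m\<bar>" if "A \<le> x" "x \<le> B" for n m x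
    by (rule singular_bvp_comparison[OF h_cont h_cont h'_cont h'_cont h_der(1) h_der(1)
          h_der(2) h_der(2) h_pos h_pos r(2) _ _ that])
       (auto simp: h_bd)
  have "\<exists>L. (\<lambda>n. h n x) \<longlonglongrightarrow> L" if x: "A \<le> x" "x \<le> B" for x
  proof -
    have "Cauchy \<delta>" using \<delta>_lim by (rule LIMSEQ_imp_Cauchy)
    then have "Cauchy (\<lambda>n. h n x)"
      unfolding Cauchy_def dist_real_def using h_diff[OF x] by (meson le_less_trans)
    then show ?thesis using real_Cauchy_convergent convergent_def by blast
  qed
  then obtain H where H: "\<And>x. A \<le> x \<Longrightarrow> x \<le> B \<Longrightarrow> (\<lambda>n. h n x) \<longlonglongrightarrow> H x"
    by metis
  have hH: "\<bar>h n x - H x\<bar> \<le> \<delta> n" if x: "A \<le> x" "x \<le> B" for n x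
  proof -
    have "(\<lambda>m. \<bar>h n x - h m x\<bar>) \<longlonglongrightarrow> \<bar>h n x - H x\<bar>"
      by (intro tendsto_intros H x)
    moreover have "(\<lambda>m. \<bar>\<delta> n - \<delta> m\<bar>) \<longlonglongrightarrow> \<bar>\<delta> n - 0\<bar>"
      by (intro tendsto_intros \<delta>_lim)
    ultimately have "\<bar>h n x - H x\<bar> \<le> \<bar>\<delta> n - 0\<bar>"
      by (rule LIMSEQ_le) (use h_diff[OF x] in auto)
    then show ?thesis using \<delta>(1)[of n] by simp
  qed
  have "uniform_limit {A..B} h H sequentially"
  proof (rule uniform_limitI)
    fix e :: real assume "0 < e"
    with \<delta>_lim have "\<forall>\<^sub>F n in sequentially. \<delta> n < e" by (rule order_tendstoD(2))
    then show "\<forall>\<^sub>F n in sequentially. \<forall>x\<in>{A..B}. dist (h n x) (H x) < e"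
    proof eventually_elim
      case (elim n)
      then show ?case using le_less_trans[OF hH[of _ n]] by (auto simp: dist_real_def abs_minus_commute)
    qed
  qed
  then have H_cont: "continuous_on {A..B} H"
    by (intro uniform_limit_theorem[where F = sequentially and f = h]) (simp_all add: h_cont)
  have H_bd: "H A = 0" "H B = 0"
  proof -
    have "(\<lambda>n. h n A) \<longlonglongrightarrow> 0" "(\<lambda>n. h n B) \<longlonglongrightarrow> 0"
      using \<delta>_lim by (simp_all only: h_bd)
    then show "H A = 0" "H B = 0"
      using H[of A] H[of B] LIMSEQ_unique assms(1) by (meson less_imp_le order_refl)+
  qed
  have "bounded (h 0 ` {A..B})"
    by (intro compact_imp_bounded compact_continuous_image h_cont) auto
  then obtain C where C: "0 < C" "\<And>x. A \<le> x \<Longrightarrow> x \<le> B \<Longrightarrow> h 0 x \<le> C"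
    unfolding bounded_pos by (fastforce simp: abs_le_iff)
  \<comment> \<open>\<open>C\<close> bounds \<open>h 0\<close>, and every other \<open>h n\<close>
    differs from it by at most \<open>1\<close> because all \<open>\<delta> n\<close> lie in
    \<open>(0, 1]\<close>.\<close>
  define M where "M = C + 1"
  have M: "0 < M" using C by (simp add: M_def)
  have h_le: "h n x \<le> M" if "A \<le> x" "x \<le> B" for n x
    using h_diff[OF that, of n 0] C(2)[OF that] \<delta>[of n] \<delta>[of 0] by (simp add: M_def)
  have "continuous_on {A..B} (\<lambda>x. r x / M)"
    using M by (intro continuous_intros r(1)) auto
  \<comment> \<open>The lower barrier: its source \<open>r / M\<close> is at most
    \<open>r / h n\<close> for every \<open>n\<close>, so \<open>h n - X\<close> is concave and
    nonnegative at the ends.\<close>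
  from dirichlet_solution[OF assms(1) this, of 0 0]
  obtain X X' where X: "continuous_on {A..B} X" "X A = 0" "X B = 0"
    and X_der: "\<And>x. A < x \<Longrightarrow> x < B \<Longrightarrow> (X has_real_derivative X' x) (at x)"
      "\<And>x. A < x \<Longrightarrow> x < B \<Longrightarrow> (X' has_real_derivative - (r x / M)) (at x)"
    by blast
  have X_pos: "0 < X x" if x: "A < x" "x < B" for x
  proof -
    \<comment> \<open>Positivity of \<open>r\<close> off \<open>z\<close> makes \<open>X\<close>
      strictly concave, hence strictly above its zero chord.\<close>
    have X'_dec: "X' v < X' u" if uv: "A < u" "u < v" "v < B" for u v
    proof -
      have "continuous_on {A<..<B} (\<lambda>x. - X' x)"
        by (intro continuous_at_imp_continuous_on ballI continuous_minus DERIV_isCont[OF X_der(2)]) auto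
      moreover have "((\<lambda>x. - X' x) has_real_derivative r x / M) (at x)" if "A < x" "x < B" for x
        using X_der(2)[OF that] by (auto intro!: derivative_eq_intros)
      ultimately have "- X' u < - X' v"
        by (rule increasing_off_point(2)[of A B "\<lambda>x. - X' x" z "\<lambda>x. r x / M"])
           (use uv r M in \<open>auto simp: less_imp_le\<close>)
      then show ?thesis by simp
    qed
    have "(B - x) * X A + (x - A) * X B < (B - A) * X x"
      by (rule above_chord(2)[OF X(1) X_der(1) _ x]) (use X'_dec in \<open>auto simp: less_imp_le\<close>)
    then show ?thesis using assms(1) by (simp add: X zero_less_mult_iff)
  qed
  have X_le_h: "X x \<le> h n x" if x: "A \<le> x" "x \<le> B" for n x
  proof -
    have "0 \<le> h n x - X x"
    proof (rule nonneg_of_second_derivative_nonpos[where p' = "\<lambda>x. h' n x - X' x"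
        and p = "\<lambda>x. h n x - X x" and p'' = "\<lambda>x. - r x / h n x - (- (r x / M))", OF _ _ _ _ _ _ x])
      show "continuous_on {A..B} (\<lambda>x. h n x - X x)" by (intro continuous_intros h_cont X)
      fix x assume x: "A < x" "x < B"
      show "((\<lambda>x. h n x - X x) has_real_derivative h' n x - X' x) (at x)"
        by (intro DERIV_diff h_der X_der x)
      show "((\<lambda>x. h' n x - X' x) has_real_derivative - r x / h n x - (- (r x / M))) (at x)"
        by (intro DERIV_diff h_der X_der x)
      have "r x / M \<le> r x / h n x"
        using h_pos[OF x] h_le[of x n] r(2)[of x] x by (intro divide_left_mono) (auto simp: M)
      then show "- r x / h n x - (- (r x / M)) \<le> 0" by simp
    qed (simp_all add: h_bd X \<delta> less_imp_le)
    then show ?thesis by simp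
  qed
  have X_le_H: "X x \<le> H x" if "A \<le> x" "x \<le> B" for x
    by (rule LIMSEQ_le_const[OF H[OF that]]) (use X_le_h[OF that] in blast)
  have "bounded (r ` {A..B})"
    by (intro compact_imp_bounded compact_continuous_image r(1)) auto
  then obtain R where R: "0 < R" "\<And>x. A \<le> x \<Longrightarrow> x \<le> B \<Longrightarrow> r x \<le> R"
    unfolding bounded_pos by (fastforce simp: abs_le_iff)
  \<comment> \<open>On a compact subinterval \<open>H\<close> is bounded away from \<open>0\<close>,
    so the linear problem with source \<open>r / H\<close> and the boundary values of
    \<open>H\<close> has a solution \<open>Y\<close>. The \<open>h n\<close> converge to
    \<open>Y\<close> as well, hence \<open>H = Y\<close> there.\<close>
  have local: "\<exists>Y Y'. \<forall>x. c < x \<longrightarrow> x < d \<longrightarrow> H x = Y x \<and> (Y has_real_derivative Y' x) (at x) \<and>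
      (Y' has_real_derivative - r x / H x) (at x)" if cd: "A < c" "c < d" "d < B" for c d
  proof -
    have sub: "{c..d} \<subseteq> {A..B}" using cd by auto
    have "\<exists>x\<in>{c..d}. \<forall>y\<in>{c..d}. X x \<le> X y"
      by (rule continuous_attains_inf) (use cd continuous_on_subset[OF X(1) sub] in auto)
    then obtain x0 where x0: "x0 \<in> {c..d}" "\<And>y. y \<in> {c..d} \<Longrightarrow> X x0 \<le> X y" by blast
    define m where "m = X x0"
    have m: "0 < m" using X_pos[of x0] x0(1) cd by (auto simp: m_def)
    have hm: "m \<le> h n x" "m \<le> H x" if "x \<in> {c..d}" for n x
      using x0(2)[OF that] X_le_h[of x n] X_le_H[of x] that sub by (auto simp: m_def)
    have "continuous_on {c..d} (\<lambda>x. r x / H x)"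
      by (intro continuous_intros continuous_on_subset[OF H_cont sub] continuous_on_subset[OF r(1) sub])
         (use hm m in force)
    from dirichlet_solution[OF cd(2) this, of "H c" "H d"]
    obtain Y Y' where Y: "continuous_on {c..d} Y" "Y c = H c" "Y d = H d"
      and Y_der: "\<And>x. c < x \<Longrightarrow> x < d \<Longrightarrow> (Y has_real_derivative Y' x) (at x)"
        "\<And>x. c < x \<Longrightarrow> x < d \<Longrightarrow> (Y' has_real_derivative - (r x / H x)) (at x)"
      by blast
    have "H x = Y x" if x: "c < x" "x < d" for x
    proof -
      \<comment> \<open>With \<open>h n\<close> and \<open>H\<close> at least \<open>m\<close>, the
        sources differ by at most \<open>R * \<delta> n / m\<^sup>2\<close>; the extra
        \<open>/ 2\<close> matches the form \<open>2 * e\<close> in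
        \<open>second_order_stability\<close>.\<close>
      have est: "\<bar>h n x - Y x\<bar> \<le> \<delta> n + (R * \<delta> n / m\<^sup>2 / 2) * ((x - c) * (d - x))" for n
      proof (rule second_order_stability[where p' = "\<lambda>x. h' n x - Y' x"
          and p'' = "\<lambda>x. - r x / h n x - (- (r x / H x))" and p = "\<lambda>x. h n x - Y x"])
        show "continuous_on {c..d} (\<lambda>x. h n x - Y x)"
          by (intro continuous_intros Y continuous_on_subset[OF h_cont sub])
        show "\<bar>h n c - Y c\<bar> \<le> \<delta> n" "\<bar>h n d - Y d\<bar> \<le> \<delta> n"
          using hH[of c n] hH[of d n] cd by (auto simp: Y)
        fix y assume y: "c < y" "y < d"
        then have y': "A < y" "y < B" "y \<in> {c..d}" using cd by auto
        show "((\<lambda>x. h n x - Y x) has_real_derivative h' n y - Y' y) (at y)"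
          by (intro DERIV_diff h_der Y_der y y')
        show "((\<lambda>x. h' n x - Y' x) has_real_derivative - r y / h n y - (- (r y / H y))) (at y)"
          by (intro DERIV_diff h_der Y_der y y')
        have pos: "0 < h n y" "0 < H y" using hm[OF y'(3)] m by (auto intro: less_le_trans)
        then have "- r y / h n y - (- (r y / H y)) = r y * (h n y - H y) / (h n y * H y)"
          by (simp add: field_simps)
        then have "\<bar>- r y / h n y - (- (r y / H y))\<bar> = r y * \<bar>h n y - H y\<bar> / (h n y * H y)"
          using pos r(2)[of y] by (simp add: abs_mult)
        also have "\<dots> \<le> R * \<delta> n / (m * m)"
          using pos r(2)[of y] R hH[of y n] y' hm[OF y'(3)] m
          by (intro frac_le mult_mono) (auto simp: less_imp_le)
        finally show "\<bar>- r y / h n y - (- (r y / H y))\<bar> \<le> 2 * (R * \<delta> n / m\<^sup>2 / 2)"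
          by (simp add: power2_eq_square)
      qed (use x in auto)
      have "(\<lambda>n. \<bar>h n x - Y x\<bar>) \<longlonglongrightarrow> \<bar>H x - Y x\<bar>"
        by (intro tendsto_intros H) (use x cd in auto)
      moreover have "(\<lambda>n. \<delta> n + (R * \<delta> n / m\<^sup>2 / 2) * ((x - c) * (d - x))) \<longlonglongrightarrow>
          0 + (R * 0 / m\<^sup>2 / 2) * ((x - c) * (d - x))"
        using m by (intro tendsto_intros \<delta>_lim) auto
      ultimately have "\<bar>H x - Y x\<bar> \<le> 0 + (R * 0 / m\<^sup>2 / 2) * ((x - c) * (d - x))"
        by (rule LIMSEQ_le) (use est in auto)
      then show ?thesis by simp
    qed
    then show ?thesis using Y_der by (metis minus_divide_left)
  qed
  \<comment> \<open>The functions \<open>Y'\<close> depend on the window \<open>(c, d)\<close>;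
    \<open>deriv H\<close> is a single derivative that agrees with all of them.\<close>
  have "0 < H x \<and> (H has_real_derivative deriv H x) (at x) \<and>
       (deriv H has_real_derivative - r x / H x) (at x)" if x: "A < x" "x < B" for x
  proof -
    define c d where "c = (A + x) / 2" and "d = (x + B) / 2"
    have cd: "A < c" "c < x" "x < d" "d < B" using x by (auto simp: c_def d_def)
    then have "c < d" by linarith
    from local[OF cd(1) this cd(4)]
    obtain Y Y' where Y: "\<And>x. c < x \<Longrightarrow> x < d \<Longrightarrow> H x = Y x"
      "\<And>x. c < x \<Longrightarrow> x < d \<Longrightarrow> (Y has_real_derivative Y' x) (at x)"
      "\<And>x. c < x \<Longrightarrow> x < d \<Longrightarrow> (Y' has_real_derivative - r x / H x) (at x)"
      by blast
    have H_der: "(H has_real_derivative Y' y) (at y)" if "c < y" "y < d" for y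
      by (rule has_field_derivative_transform_within_open[OF Y(2)[OF that], of "{c<..<d}"])
         (use that Y(1) in auto)
    have "Y' y = deriv H y" if "y \<in> {c<..<d}" for y
      using that DERIV_imp_deriv[OF H_der[of y]] by simp
    then have "(deriv H has_real_derivative - r x / H x) (at x)"
      using cd by (intro has_field_derivative_transform_within_open[OF Y(3)[OF cd(2,3)], of "{c<..<d}"]) auto
    moreover have "(H has_real_derivative deriv H x) (at x)"
      using H_der[OF cd(2,3)] by (simp add: DERIV_imp_deriv)
    moreover have "0 < H x" using X_pos[OF x] X_le_H[of x] x by simp
    ultimately show ?thesis by blast
  qed
  then show ?thesis using H_cont H_bd
    by - (rule exI[of _ H], rule exI[of _ "deriv H"], simp)
qed

section \<open>Divergence of the slope at the ends\<close>

text \<open>A lower bound \<open>- L\<close> for \<open>h'\<close> gives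
  \<open>h x <= L * (B - x)\<close>, so near \<open>B\<close> the second derivative is at most
  \<open>- m / (L * (B - x))\<close>. This integrates to a logarithm tending to minus infinity, a
  contradiction.\<close>

lemma singular_slope_unbounded:
  fixes h h' r :: "real \<Rightarrow> real"
  assumes "A < B" "z < B" and cont: "continuous_on {A..B} h" "h B = 0"
    and pos: "\<And>x. A < x \<Longrightarrow> x < B \<Longrightarrow> 0 < h x"
    and der: "\<And>x. A < x \<Longrightarrow> x < B \<Longrightarrow> (h has_real_derivative h' x) (at x)"
      "\<And>x. A < x \<Longrightarrow> x < B \<Longrightarrow> (h' has_real_derivative - r x / h x) (at x)"
    and r: "continuous_on {A..B} r" "\<And>x. x \<noteq> z \<Longrightarrow> 0 < r x"
  shows "\<exists>x. A < x \<and> x < B \<and> h' x < K"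
proof (rule ccontr)
  assume "\<not> ?thesis"
  then have K: "K \<le> h' x" if "A < x" "x < B" for x using that by force
  define L where "L = max 1 (- K)"
  have L: "0 < L" by (simp add: L_def)
  have h'_ge: "- L \<le> h' x" if "A < x" "x < B" for x
    using K[OF that] by (simp add: L_def)
  have h_le: "h x \<le> L * (B - x)" if x: "A < x" "x < B" for x
  proof -
    have "continuous_on {x..B} h"
      by (rule continuous_on_subset[OF cont(1)]) (use x in auto)
    moreover have "(h has_derivative (\<lambda>t. h' y * t)) (at y)" if "x < y" "y < B" for y
      using der(1)[of y] that x by (simp add: has_field_derivative_def)
    ultimately obtain c where "x < c" "c < B" "h B - h x = (\<lambda>t. h' c * t) (B - x)"
      using mvt[OF x(2), of h "\<lambda>y t. h' y * t"] by blast
    then have c: "x < c" "c < B" "h B - h x = h' c * (B - x)" by auto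
    have "- L * (B - x) \<le> h' c * (B - x)"
      using h'_ge[of c] c x by (intro mult_right_mono) auto
    then show ?thesis using c(3) cont(2) by simp
  qed
  \<comment> \<open>\<open>c\<close> lies to the right of \<open>z\<close>, so \<open>r\<close> has
    a positive minimum \<open>m\<close> on \<open>{c..B}\<close>.\<close>
  define c where "c = max ((A + B) / 2) ((z + B) / 2)"
  have c: "A < c" "z < c" "c < B" using assms(1,2) by (auto simp: c_def less_max_iff_disj)
  have "\<exists>x\<in>{c..B}. \<forall>y\<in>{c..B}. r x \<le> r y"
    by (rule continuous_attains_inf) (use c in \<open>auto intro: continuous_on_subset[OF r(1)]\<close>)
  then obtain x0 where x0: "x0 \<in> {c..B}" "\<And>y. y \<in> {c..B} \<Longrightarrow> r x0 \<le> r y" by blast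
  define m where "m = r x0"
  have m: "0 < m" using r(2)[of x0] x0(1) c by (auto simp: m_def)
  define q where "q x = h' x - m / L * ln (B - x)" for x
  have q_dec: "q x \<le> q c" if x: "c \<le> x" "x < B" for x
  proof (rule DERIV_nonpos_imp_nonincreasing[OF x(1)])
    fix y assume y: "c \<le> y" "y \<le> x"
    then have y': "A < y" "y < B" "y \<in> {c..B}" using c x by auto
    have "(q has_real_derivative - r y / h y + m / (L * (B - y))) (at y)"
      unfolding q_def using y' L
      by (auto intro!: derivative_eq_intros der(2) simp: field_simps)
    moreover have "m / (L * (B - y)) \<le> r y / h y"
      using x0(2)[OF y'(3)] m h_le[OF y'(1,2)] pos[OF y'(1,2)] by (intro frac_le) (auto simp: m_def)
    ultimately show "\<exists>d. (q has_real_derivative d) (at y) \<and> d \<le> 0"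
      by (intro exI[of _ "- r y / h y + m / (L * (B - y))"]) auto
  qed
  \<comment> \<open>With \<open>B - x = (B - c) * exp (- t)\<close> the logarithm drops by exactly
    \<open>t\<close>, and this \<open>t\<close> forces \<open>h' x <= - L - 1\<close>.\<close>
  define t where "t = (h' c + L + 1) * L / m"
  have t: "0 < t" using h'_ge[OF c(1,3)] L m by (simp add: t_def)
  define E where "E = (B - c) * exp (- t)"
  define x where "x = B - E"
  have "E \<le> (B - c) * 1" unfolding E_def using c t by (intro mult_left_mono) auto
  moreover have "0 < E" unfolding E_def using c by (intro mult_pos_pos) auto
  ultimately have x: "c \<le> x" "x < B" by (auto simp: x_def)
  have "ln (B - x) = ln (B - c) - t" using c by (simp add: x_def E_def ln_mult)
  moreover have "h' x \<le> h' c + m / L * (ln (B - x) - ln (B - c))"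
    using q_dec[OF x] by (simp add: q_def right_diff_distrib)
  ultimately have "h' x \<le> h' c - m / L * t" by simp
  moreover have "m / L * t = h' c + L + 1" using L m by (simp add: t_def)
  ultimately show False using h'_ge[of x] x c by auto
qed

section \<open>Regularity inside each phase\<close>

text \<open>Bootstrapping: the right-hand side is a \<open>C\<^sup>1\<close> function of
  \<open>f\<close> wherever \<open>c (f x)\<close> is nonzero, so one differentiable
  \<open>f\<close> is automatically twice continuously differentiable. \<open>D\<close> is the
  quotient rule for \<open>F\<close>.\<close>

lemma C2_on_quotient_ode:
  fixes f h c :: "real \<Rightarrow> real"
  assumes "open S"
    and f: "\<And>x. x \<in> S \<Longrightarrow> (f has_real_derivative - h (f x) / c (f x)) (at x)"
    and h: "\<And>x. x \<in> S \<Longrightarrow> (h has_real_derivative h' (f x)) (at (f x))" "continuous_on (f ` S) h'"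
    and c: "\<And>x. x \<in> S \<Longrightarrow> (c has_real_derivative c' (f x)) (at (f x))" "continuous_on (f ` S) c'"
      "\<And>x. x \<in> S \<Longrightarrow> c (f x) \<noteq> 0"
  shows "C2_on S f"
proof -
  define F where "F x = - h (f x) / c (f x)" for x
  define D where "D x = (h (f x) * c' (f x) - h' (f x) * c (f x)) * F x / (c (f x))\<^sup>2" for x
  have f': "(f has_real_derivative F x) (at x)" if "x \<in> S" for x
    using f[OF that] by (simp add: F_def)
  have "(F has_real_derivative D x) (at x)" if x: "x \<in> S" for x
  proof -
    have "((\<lambda>x. h (f x)) has_real_derivative h' (f x) * F x) (at x)"
      "((\<lambda>x. c (f x)) has_real_derivative c' (f x) * F x) (at x)"
      using DERIV_chain2[OF h(1)[OF x] f'[OF x]] DERIV_chain2[OF c(1)[OF x] f'[OF x]] by auto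
    then show ?thesis unfolding F_def[abs_def] D_def
      using c(3)[OF x]
      by (auto intro!: derivative_eq_intros simp: F_def field_simps power2_eq_square)
  qed
  then have f'': "(deriv f has_real_derivative D x) (at x)" if "x \<in> S" for x
    using that DERIV_imp_deriv[OF f']
    by (intro has_field_derivative_transform_within_open[of F "D x" x S "deriv f"] assms(1)) auto
  have cont_f: "continuous_on S f" "continuous_on (f ` S) h" "continuous_on (f ` S) c"
    by (auto intro!: continuous_at_imp_continuous_on DERIV_isCont f' h(1) c(1))
  have comp: "continuous_on S (\<lambda>x. k (f x))" if "continuous_on (f ` S) k" for k :: "real \<Rightarrow> real"
    by (rule continuous_on_compose2[OF that cont_f(1)]) auto
  have "continuous_on S D"
    unfolding D_def[abs_def] F_def
    by (intro continuous_intros comp h(2) c(2) cont_f) (use c(3) in auto)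
  then have "continuous_on S (deriv (deriv f))"
    using DERIV_imp_deriv[OF f''] by (simp cong: continuous_on_cong)
  then show ?thesis unfolding C2_on_def field_differentiable_def
    using f' f'' by blast
qed

subsection \<open>The hodograph transformation\<close>

text \<open>\<open>h'\<close> is strictly decreasing, since \<open>r / h\<close> is positive off
  \<open>0\<close>, and unbounded at both ends; so \<open>2 * h'\<close> is a bijection from
  \<open>(A, B)\<close> onto the line, and \<open>f\<close> is its inverse.\<close>

lemma hodograph_inverse:
  fixes h h' r :: "real \<Rightarrow> real"
  assumes AB: "A < 0" "0 < B" and cont: "continuous_on {A..B} h" "h A = 0" "h B = 0"
    and pos: "\<And>x. A < x \<Longrightarrow> x < B \<Longrightarrow> 0 < h x"
    and der: "\<And>x. A < x \<Longrightarrow> x < B \<Longrightarrow> (h has_real_derivative h' x) (at x)"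
      "\<And>x. A < x \<Longrightarrow> x < B \<Longrightarrow> (h' has_real_derivative - r x / h x) (at x)"
    and r: "continuous_on {A..B} r" "\<And>x. 0 \<le> r x" "\<And>x. x \<noteq> 0 \<Longrightarrow> 0 < r x"
  obtains f where "\<And>\<eta>. A < f \<eta>" "\<And>\<eta>. f \<eta> < B" "\<And>\<eta>. 2 * h' (f \<eta>) = \<eta>"
    "\<And>u. A < u \<Longrightarrow> u < B \<Longrightarrow> f (2 * h' u) = u"
    "\<And>x y. x < y \<Longrightarrow> f y < f x" "\<And>\<eta>. isCont f \<eta>"
proof -
  have "A < B" using AB by linarith
  have contm: "continuous_on {A<..<B} (\<lambda>x. - h' x)"
    by (intro continuous_at_imp_continuous_on ballI continuous_minus DERIV_isCont[OF der(2)]) auto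
  have dec: "h' y < h' x" if xy: "A < x" "x < y" "y < B" for x y
  proof -
    have "((\<lambda>x. - h' x) has_real_derivative r x / h x) (at x)" if "A < x" "x < B" for x
      using der(2)[OF that] by (auto intro!: derivative_eq_intros)
    then have "- h' x < - h' y"
      by (intro increasing_off_point(2)[OF contm, of 0 "\<lambda>x. r x / h x"] xy)
         (use pos r in \<open>auto simp: less_imp_le\<close>)
    then show ?thesis by simp
  qed
  have inj: "x = y" if "A < x" "x < B" "A < y" "y < B" "h' x = h' y" for x y
    using dec[of x y] dec[of y x] that by (cases x y rule: linorder_cases) auto
  have below: "\<exists>x. A < x \<and> x < B \<and> h' x < K" for K
    by (rule singular_slope_unbounded[OF \<open>A < B\<close> AB(2) cont(1,3) pos der r(1,3)]) auto
  \<comment> \<open>The reflection \<open>x \<mapsto> - x\<close> moves the left end to the right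
    and replaces \<open>h'\<close> by \<open>- h' (- x)\<close>.\<close>
  have above: "\<exists>x. A < x \<and> x < B \<and> K < h' x" for K
  proof -
    have cm: "continuous_on {-B..-A} (\<lambda>x. k (- x))" if "continuous_on {A..B} k" for k :: "real \<Rightarrow> real"
      by (rule continuous_on_compose2[OF that]) (auto intro!: continuous_intros)
    have "\<exists>x. - B < x \<and> x < - A \<and> - h' (- x) < - K"
    proof (rule singular_slope_unbounded[where h = "\<lambda>x. h (- x)" and r = "\<lambda>x. r (- x)" and z = 0])
      fix x assume x: "- B < x" "x < - A"
      show "((\<lambda>x. h (- x)) has_real_derivative - h' (- x)) (at x)"
        using der(1)[of "- x"] x by (simp add: DERIV_mirror)
      have "((\<lambda>x. h' (- x)) has_real_derivative - (- r (- x) / h (- x))) (at x)"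
        using der(2)[of "- x"] x by (subst DERIV_mirror[symmetric]) simp
      then show "((\<lambda>x. - h' (- x)) has_real_derivative - r (- x) / h (- x)) (at x)"
        by (auto intro!: derivative_eq_intros)
    qed (use AB cont r pos in \<open>auto intro!: cm\<close>)
    then obtain x where "- B < x" "x < - A" "- h' (- x) < - K" by blast
    then show ?thesis by (intro exI[of _ "- x"]) auto
  qed
  have "\<exists>u. A < u \<and> u < B \<and> 2 * h' u = \<eta>" for \<eta>
  proof -
    obtain x y where x: "A < x" "x < B" "h' x < \<eta> / 2" and y: "A < y" "y < B" "\<eta> / 2 < h' y"
      using above below by blast
    have "connected (h' ` {A<..<B})"
      using continuous_on_minus[OF contm] by (intro connected_continuous_image) auto
    from connectedD_interval[OF this, of "h' x" "h' y" "\<eta> / 2"]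
    have "\<eta> / 2 \<in> h' ` {A<..<B}" using x y by auto
    then show ?thesis by auto
  qed
  then obtain f where f: "\<And>\<eta>. A < f \<eta>" "\<And>\<eta>. f \<eta> < B" "\<And>\<eta>. 2 * h' (f \<eta>) = \<eta>" by metis
  have left_inv: "f (2 * h' u) = u" if "A < u" "u < B" for u
    using f[of "2 * h' u"] inj[of "f (2 * h' u)" u] that by auto
  show thesis
  proof (rule that[OF f left_inv])
    show "f y < f x" if "x < y" for x y
      using dec[of "f x" "f y"] f[of x] f[of y] that by (cases "f x" "f y" rule: linorder_cases) auto
    show "isCont f \<eta>" for \<eta>
    proof -
      define u where "u = f \<eta>"
      have u: "A < u" "u < B" "\<eta> = 2 * h' u" using f[of \<eta>] by (auto simp: u_def)
      have "isCont f ((\<lambda>u. 2 * h' u) u)"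
        by (rule isCont_inverse_function2[where f = "\<lambda>u. 2 * h' u" and a = "(A + u) / 2" and b = "(u + B) / 2"])
           (use u in \<open>auto intro!: left_inv continuous_intros DERIV_isCont[OF der(2)]\<close>)
      then show ?thesis using u(3) by simp
    qed
  qed auto
qed

section \<open>Existence for the free boundary problem\<close>

locale two_phase =
  fixes \<phi> :: "real \<Rightarrow> real" and \<epsilon> U V :: real
  assumes C2: "C2_on UNIV \<phi>"
    and mono: "strict_mono_on {0..} (deriv \<phi>)"
    and zero: "deriv \<phi> 0 = 0"
    and eps: "0 < \<epsilon>" and U: "0 < U" and V: "0 < V"
begin

text \<open>The factor \<open>1/2\<close> comes from \<open>\<eta> = 2 * h' u\<close>: in the
  positive phase \<open>f' = - h / \<phi>'\<close>, so
  \<open>h'' = 1 / (2 * f') = - (\<phi>' / 2) / h\<close>, and likewise in the other phase.\<close>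

definition r :: "real \<Rightarrow> real" where
  "r u = (if 0 \<le> u then deriv \<phi> u else \<epsilon> * deriv \<phi> (- u)) / 2"

lemma r_simps: "0 \<le> u \<Longrightarrow> r u = deriv \<phi> u / 2" "u \<le> 0 \<Longrightarrow> r u = \<epsilon> * deriv \<phi> (- u) / 2"
  by (auto simp: r_def zero)

lemma phi'_der: "(deriv \<phi> has_real_derivative deriv (deriv \<phi>) s) (at s)"
  using C2 by (auto simp: C2_on_def field_differentiable_derivI)

lemma phi'_cont: "continuous_on S (deriv \<phi>)"
  by (intro continuous_at_imp_continuous_on ballI DERIV_isCont[OF phi'_der])

lemma phi''_cont: "continuous_on S (deriv (deriv \<phi>))"
  using C2 by (auto simp: C2_on_def intro: continuous_on_subset)

lemma phi'_pos: "0 < s \<Longrightarrow> 0 < deriv \<phi> s"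
  using strict_mono_onD[OF mono, of 0 s] zero by simp

lemma r_cont: "continuous_on S r"
proof -
  have "continuous_on ({0..} \<union> {..0}) (\<lambda>u. if 0 \<le> u then deriv \<phi> u else \<epsilon> * deriv \<phi> (- u))"
    by (rule continuous_on_cases)
       (auto intro!: continuous_intros phi'_cont continuous_on_compose2[OF phi'_cont[of UNIV]] simp: zero)
  moreover have "{0..} \<union> {..0} = (UNIV :: real set)" by auto
  ultimately have "continuous_on UNIV r" unfolding r_def[abs_def]
    by (intro continuous_intros) auto
  then show ?thesis by (rule continuous_on_subset) auto
qed

lemma r_pos: "u \<noteq> 0 \<Longrightarrow> 0 < r u"
  using phi'_pos[of u] phi'_pos[of "- u"] eps by (auto simp: r_def)

lemma r_nonneg: "0 \<le> r u"
  using r_pos[of u] by (cases "u = 0") (auto simp: r_def zero)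

text \<open>Inverting \<open>2 * h'\<close> gives \<open>f\<close> with flux
  \<open>- h (f \<eta>)\<close> in both phases, so continuity of \<open>h\<close> at
  \<open>0\<close> is the flux condition at \<open>a = 2 * h' 0\<close>.\<close>

lemma solution_exists: "\<exists>f a. free_boundary_solution \<phi> \<epsilon> U V f a"
proof -
  obtain h h' where h: "continuous_on {- V..U} h" "h (- V) = 0" "h U = 0"
    and h_pos: "\<And>x. - V < x \<Longrightarrow> x < U \<Longrightarrow> 0 < h x"
    and h_der: "\<And>x. - V < x \<Longrightarrow> x < U \<Longrightarrow> (h has_real_derivative h' x) (at x)"
      "\<And>x. - V < x \<Longrightarrow> x < U \<Longrightarrow> (h' has_real_derivative - r x / h x) (at x)"
  proof -
    have "- V < U" using U V by linarith
    from singular_bvp_exists[OF this r_cont r_nonneg r_pos] show thesis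
      using that by blast
  qed
  obtain f where f: "\<And>\<eta>. - V < f \<eta>" "\<And>\<eta>. f \<eta> < U" "\<And>\<eta>. 2 * h' (f \<eta>) = \<eta>"
    "\<And>u. - V < u \<Longrightarrow> u < U \<Longrightarrow> f (2 * h' u) = u"
    and f_dec: "\<And>x y. x < y \<Longrightarrow> f y < f x" and f_cont: "\<And>\<eta>. isCont f \<eta>"
    using hodograph_inverse[of "- V" U h h' r] h h_pos h_der r_cont r_nonneg r_pos U V
    by (smt (verit, del_insts))
  define a where "a = 2 * h' 0"
  have fa: "f a = 0" using f(4)[of 0] U V by (simp add: a_def)
  have f_pos: "0 < f \<eta>" if "\<eta> < a" for \<eta> using f_dec[OF that] fa by simp
  have f_neg: "f \<eta> < 0" if "a < \<eta>" for \<eta> using f_dec[OF that] fa by simp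
  \<comment> \<open>The point \<open>a\<close> is excluded because \<open>r 0 = 0\<close>, so the
    derivative of \<open>2 * h'\<close> vanishes at \<open>f a = 0\<close>.\<close>
  have f_der: "(f has_real_derivative - h (f \<eta>) / (2 * r (f \<eta>))) (at \<eta>)" if "\<eta> \<noteq> a" for \<eta>
  proof -
    have fnz: "f \<eta> \<noteq> 0" using f_pos[of \<eta>] f_neg[of \<eta>] that by (cases "\<eta> < a") auto
    have nz: "r (f \<eta>) \<noteq> 0" "h (f \<eta>) \<noteq> 0" using r_pos[OF fnz] h_pos[OF f(1,2)[of \<eta>]] by auto
    have "((\<lambda>u. 2 * h' u) has_real_derivative 2 * (- r (f \<eta>) / h (f \<eta>))) (at (f \<eta>))"
      by (intro DERIV_cmult h_der(2) f)
    then have "(f has_real_derivative inverse (2 * (- r (f \<eta>) / h (f \<eta>)))) (at \<eta>)"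
      by (rule DERIV_inverse_function[where a = "\<eta> - 1" and b = "\<eta> + 1"]) (use nz f f_cont in auto)
    then show ?thesis by (simp add: divide_simps)
  qed
  have df: "deriv f \<eta> = - h (f \<eta>) / (2 * r (f \<eta>))" if "\<eta> \<noteq> a" for \<eta>
    using DERIV_imp_deriv[OF f_der[OF that]] .
  \<comment> \<open>Since \<open>h' (f \<eta>) = \<eta> / 2\<close>, the chain rule yields the
    differential equation; only the identification of \<open>- h (f x)\<close> with the flux is
    left.\<close>
  have hf_der: "((\<lambda>x. - h (f x)) has_real_derivative - (1/2) * \<eta> * deriv f \<eta>) (at \<eta>)"
    if "\<eta> \<noteq> a" for \<eta>
  proof -
    have "((\<lambda>x. - h (f x)) has_real_derivative - (h' (f \<eta>) * (- h (f \<eta>) / (2 * r (f \<eta>))))) (at \<eta>)"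
      by (intro DERIV_minus DERIV_chain2[OF h_der(1)] f f_der that)
    moreover have "h' (f \<eta>) = \<eta> / 2" using f(3)[of \<eta>] by simp
    ultimately show ?thesis using df[OF that] by simp
  qed
  have h'_cont: "continuous_on (f ` S) h'" for S
    by (intro continuous_at_imp_continuous_on ballI DERIV_isCont[OF h_der(2)]) (use f in auto)
  have flux_left: "deriv \<phi> (f \<eta>) * deriv f \<eta> = - h (f \<eta>)" if "\<eta> < a" for \<eta>
    using df[of \<eta>] f_pos[OF that] phi'_pos[of "f \<eta>"] that by (simp add: r_simps)
  have flux_right: "\<epsilon> * deriv \<phi> (- f \<eta>) * deriv f \<eta> = - h (f \<eta>)" if "a < \<eta>" for \<eta>
    using df[of \<eta>] f_neg[OF that] phi'_pos[of "- f \<eta>"] that eps by (simp add: r_simps)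
  have hf_cont: "isCont (\<lambda>x. - h (f x)) \<eta>" for \<eta>
    by (intro continuous_minus isCont_o2[OF f_cont] DERIV_isCont[OF h_der(1)] f)
  have "free_boundary_solution \<phi> \<epsilon> U V f a"
    unfolding free_boundary_solution_def
  proof (intro conjI allI impI)
    show "continuous_on UNIV f" using f_cont by (simp add: continuous_at_imp_continuous_on)
    show "0 < f \<eta>" if "\<eta> < a" for \<eta> by (rule f_pos[OF that])
    show "f \<eta> < 0" if "a < \<eta>" for \<eta> by (rule f_neg[OF that])
    show "C2_on {..<a} f"
    proof (rule C2_on_quotient_ode[where h = h and h' = h' and c = "deriv \<phi>" and c' = "deriv (deriv \<phi>)"])
      fix x assume x: "x \<in> {..<a}"
      show "(f has_real_derivative - h (f x) / deriv \<phi> (f x)) (at x)"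
        using f_der[of x] f_pos[of x] x by (simp add: r_simps)
      show "deriv \<phi> (f x) \<noteq> 0" using phi'_pos[OF f_pos[of x]] x by auto
    qed (auto intro!: h_der(1) f h'_cont phi'_der phi''_cont)
    show "C2_on {a<..} f"
    proof (rule C2_on_quotient_ode[where h = h and h' = h' and c = "\<lambda>u. \<epsilon> * deriv \<phi> (- u)"
          and c' = "\<lambda>u. \<epsilon> * - deriv (deriv \<phi>) (- u)"])
      fix x assume x: "x \<in> {a<..}"
      show "(f has_real_derivative - h (f x) / (\<epsilon> * deriv \<phi> (- f x))) (at x)"
        using f_der[of x] f_neg[of x] x by (simp add: r_simps)
      show "\<epsilon> * deriv \<phi> (- f x) \<noteq> 0" using phi'_pos[of "- f x"] f_neg[of x] x eps by auto
      show "((\<lambda>u. \<epsilon> * deriv \<phi> (- u)) has_real_derivative \<epsilon> * - deriv (deriv \<phi>) (- f x)) (at (f x))"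
        using phi'_der[of "- f x"] by (intro DERIV_cmult) (simp add: DERIV_mirror)
    qed (auto intro!: h_der(1) f h'_cont continuous_intros continuous_on_compose2[OF phi''_cont[of UNIV]])
    show "((\<lambda>x. deriv \<phi> (f x) * deriv f x) has_real_derivative - (1/2) * \<eta> * deriv f \<eta>) (at \<eta>)"
      if "\<eta> < a" for \<eta>
      by (rule has_field_derivative_transform_within_open[OF hf_der, of _ "{..<a}"])
         (use that flux_left in auto)
    show "((\<lambda>x. \<epsilon> * deriv \<phi> (- f x) * deriv f x) has_real_derivative - (1/2) * \<eta> * deriv f \<eta>) (at \<eta>)"
      if "a < \<eta>" for \<eta>
      by (rule has_field_derivative_transform_within_open[OF hf_der, of _ "{a<..}"])
         (use that flux_right in auto)
    show "(f \<longlongrightarrow> U) at_bot"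
    proof (rule order_tendstoI)
      fix u assume "u < U"
      define v where "v = max u 0"
      have v: "- V < v" "v < U" "u \<le> v" using U V \<open>u < U\<close> by (auto simp: v_def)
      have "u < f \<eta>" if "\<eta> < 2 * h' v" for \<eta> using f_dec[OF that] f(4)[OF v(1,2)] v(3) by simp
      then show "\<forall>\<^sub>F \<eta> in at_bot. u < f \<eta>"
        by (rule eventually_mono[OF eventually_gt_at_bot])
    qed (auto intro!: always_eventually less_trans[OF f(2)])
    show "(f \<longlongrightarrow> - V) at_top"
    proof (rule order_tendstoI)
      fix u assume "- V < u"
      define v where "v = min u 0"
      have v: "- V < v" "v < U" "v \<le> u" using U V \<open>- V < u\<close> by (auto simp: v_def)
      have "f \<eta> < u" if "2 * h' v < \<eta>" for \<eta> using f_dec[OF that] f(4)[OF v(1,2)] v(3) by simp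
      then show "\<forall>\<^sub>F \<eta> in at_top. f \<eta> < u"
        by (rule eventually_mono[OF eventually_gt_at_top])
    qed (auto intro!: always_eventually less_trans[OF _ f(1)])
    have "(f \<longlongrightarrow> 0) (at a)" using f_cont[of a] fa by (simp add: isCont_def)
    then show "(f \<longlongrightarrow> 0) (at_left a)" "(f \<longlongrightarrow> 0) (at_right a)"
      by (auto simp: filterlim_at_split)
    have "((\<lambda>x. - h (f x)) \<longlongrightarrow> - h 0) (at a)" using hf_cont[of a] fa by (simp add: isCont_def)
    then have lim: "((\<lambda>x. - h (f x)) \<longlongrightarrow> - h 0) (at_left a)" "((\<lambda>x. - h (f x)) \<longlongrightarrow> - h 0) (at_right a)"
      by (auto simp: filterlim_at_split)
    show "\<exists>l r. ((\<lambda>\<eta>. deriv \<phi> (f \<eta>) * deriv f \<eta>) \<longlongrightarrow> l) (at_left a) \<and>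
      ((\<lambda>\<eta>. deriv \<phi> (- f \<eta>) * deriv f \<eta>) \<longlongrightarrow> r) (at_right a) \<and> l = \<epsilon> * r"
    proof (intro exI conjI)
      show "((\<lambda>\<eta>. deriv \<phi> (f \<eta>) * deriv f \<eta>) \<longlongrightarrow> - h 0) (at_left a)"
        by (rule Lim_transform_eventually[OF lim(1)])
           (auto simp: eventually_at_filter flux_left)
      \<comment> \<open>The right flux in the definition is taken without \<epsilon>, hence the
        division.\<close>
      show "((\<lambda>\<eta>. deriv \<phi> (- f \<eta>) * deriv f \<eta>) \<longlongrightarrow> - h 0 / \<epsilon>) (at_right a)"
      proof (rule Lim_transform_eventually)
        show "((\<lambda>x. - h (f x) / \<epsilon>) \<longlongrightarrow> - h 0 / \<epsilon>) (at_right a)"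
          by (intro tendsto_divide lim(2)) (use eps in auto)
        show "\<forall>\<^sub>F x in at_right a. - h (f x) / \<epsilon> = deriv \<phi> (- f x) * deriv f x"
          using flux_right eps by (auto simp: eventually_at_filter field_simps)
      qed
      show "- h 0 = \<epsilon> * (- h 0 / \<epsilon>)" using eps by simp
    qed
  qed
  then show ?thesis by blast
qed

end

section \<open>Sign and decay of the flux on a half-line\<close>

text \<open>The flux \<open>c (f x) * F x\<close> solves a linear homogeneous equation, so it has a constant sign.\<close>

lemma half_line_flux:
  fixes c f F :: "real \<Rightarrow> real"
  assumes c: "continuous_on {0..} c" "\<And>s. 0 < s \<Longrightarrow> 0 < c s"
    and pos: "\<And>x. x < a \<Longrightarrow> 0 < f x"
    and f: "\<And>x. x < a \<Longrightarrow> (f has_real_derivative F x) (at x)"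
    and flux: "\<And>x. x < a \<Longrightarrow>
      ((\<lambda>x. c (f x) * F x) has_real_derivative - (1/2) * x * F x) (at x)"
    and lim: "(f \<longlongrightarrow> U) at_bot" "(f \<longlongrightarrow> 0) (at_left a)"
  shows "\<And>x. x < a \<Longrightarrow> F x < 0" "\<And>x. x < a \<Longrightarrow> f x < U"
    "((\<lambda>x. c (f x) * F x) \<longlongrightarrow> 0) at_bot"
proof -
  define w where "w x = c (f x) * F x" for x
  have cf: "0 < c (f x)" if "x < a" for x using c(2) pos that by blast
  have w_der: "(w has_real_derivative (- (1/2) * x / c (f x)) * w x) (at x)" if "x < a" for x
    using flux[OF that] cf[OF that] by (simp add: w_def[abs_def])
  have f_cont: "continuous_on {..<a} f"
    by (intro continuous_at_imp_continuous_on ballI DERIV_isCont[OF f]) auto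
  have w_cont: "continuous_on {..<a} w"
    by (intro continuous_at_imp_continuous_on ballI DERIV_isCont[OF w_der]) auto
  \<comment> \<open>The integrating factor \<open>exp (- Q)\<close> makes
    \<open>w * exp (- Q)\<close> constant on \<open>{x..y}\<close>.\<close>
  have propagate: "\<exists>k>0. w y = k * w x" if xy: "x < y" "y < a" for x y
  proof -
    have sub: "{x..y} \<subseteq> {..<a}" using xy by auto
    have "continuous_on {x..y} (\<lambda>x. c (f x))"
      by (rule continuous_on_compose2[OF c(1) continuous_on_subset[OF f_cont sub]])
         (use pos xy in \<open>force simp: less_imp_le\<close>)
    moreover have "c (f s) \<noteq> 0" if "s \<in> {x..y}" for s using cf[of s] that xy by auto
    ultimately have "continuous_on {x..y} (\<lambda>x. - (1/2) * x / c (f x))"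
      by (intro continuous_intros) auto
    from antiderivative_continuous[OF this]
    obtain Q where Q: "\<And>s. s \<in> {x..y} \<Longrightarrow> (Q has_real_derivative - (1/2) * s / c (f s)) (at s within {x..y})"
      by (auto simp: has_real_derivative_iff_has_vector_derivative)
    have "\<exists>C. \<forall>s\<in>{x..y}. w s * exp (- Q s) = C"
    proof (rule has_field_derivative_zero_constant)
      fix s assume s: "s \<in> {x..y}"
      have "(w has_real_derivative (- (1/2) * s / c (f s)) * w s) (at s within {x..y})"
        by (rule has_field_derivative_at_within[OF w_der]) (use s xy in auto)
      then show "((\<lambda>s. w s * exp (- Q s)) has_real_derivative 0) (at s within {x..y})"
        using Q[OF s] by (auto intro!: derivative_eq_intros)
    qed auto
    then have "w x * exp (- Q x) = w y * exp (- Q y)" using xy by auto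
    then have "w y = exp (Q y) * exp (- Q x) * w x"
      by (simp add: exp_minus field_simps)
    then show ?thesis by (intro exI[of _ "exp (Q y) * exp (- Q x)"]) auto
  qed
  \<comment> \<open>Otherwise the flux stays nonnegative up to \<open>a\<close>, so \<open>f\<close>
    is nondecreasing from the positive value \<open>f x\<close> and cannot tend to
    \<open>0\<close>.\<close>
  show F_neg: "F x < 0" if x: "x < a" for x
  proof (rule ccontr)
    assume "\<not> F x < 0"
    then have "0 \<le> w x" using cf[OF x] by (simp add: w_def)
    then have w_nn: "0 \<le> w y" if "x < y" "y < a" for y
      using propagate[OF that] by auto
    have F_nn: "0 \<le> F y" if "x < y" "y < a" for y
      using w_nn[OF that] cf[OF that(2)] by (simp add: w_def zero_le_mult_iff)
    have "f x \<le> f y" if y: "x < y" "y < a" for y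
    proof (rule DERIV_nonneg_imp_increasing_open[of x y f])
      show "\<exists>d. (f has_real_derivative d) (at s) \<and> 0 \<le> d" if "x < s" "s < y" for s
        using f[of s] F_nn[of s] that y by auto
      show "continuous_on {x..y} f" by (rule continuous_on_subset[OF f_cont]) (use y in auto)
    qed (use y in auto)
    then have "\<forall>\<^sub>F y in at_left a. f x \<le> f y"
      using eventually_at_left_real[OF x] by (auto elim!: eventually_mono)
    then have "f x \<le> 0" using lim(2) by (intro tendsto_lowerbound) auto
    then show False using pos[OF x] by simp
  qed
  have f_dec: "f y < f x" if "x < y" "y < a" for x y
    by (rule DERIV_neg_imp_decreasing[OF that(1), of f]) (use F_neg f that in \<open>meson le_less_trans\<close>)
  show f_less: "f x < U" if x: "x < a" for x
  proof -
    have "\<forall>\<^sub>F y in at_bot. f (x - 1) \<le> f y"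
      using eventually_le_at_bot[of "x - 1"]
    proof eventually_elim
      case (elim y) then show ?case using f_dec[of y "x - 1"] x by (cases "y = x - 1") auto
    qed
    then have "f (x - 1) \<le> U" using lim(1) by (intro tendsto_lowerbound) auto
    then show ?thesis using f_dec[of "x - 1" x] x by simp
  qed
  have w_neg: "w x < 0" if "x < a" for x
    using cf[OF that] F_neg[OF that] by (simp add: w_def mult_pos_neg)
  have w_dec: "w y \<le> w x" if "x \<le> y" "y < a" "y < 0" for x y
  proof (rule DERIV_nonpos_imp_nonincreasing[OF that(1)])
    fix s assume "x \<le> s" "s \<le> y"
    then have s: "s < a" "s < 0" using that by auto
    have "0 \<le> s * F s" using s F_neg[of s] by (simp add: mult_nonpos_nonpos)
    then show "\<exists>d. (w has_real_derivative d) (at s) \<and> d \<le> 0"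
      using flux[OF s(1)] unfolding w_def[abs_def] by (intro exI[of _ "- (1/2) * s * F s"]) auto
  qed
  have "bounded (c ` {0..U})"
    by (intro compact_imp_bounded compact_continuous_image continuous_on_subset[OF c(1)]) auto
  then obtain C where C: "0 < C" "\<And>s. 0 \<le> s \<Longrightarrow> s \<le> U \<Longrightarrow> c s \<le> C"
    unfolding bounded_pos by (fastforce simp: abs_le_iff)
  have "(w \<longlongrightarrow> 0) at_bot"
  proof (rule order_tendstoI)
    fix e :: real assume "e < 0"
    \<comment> \<open>If \<open>w <= e < 0\<close> persisted towards minus infinity, then
      \<open>F <= e / C\<close>, and \<open>f\<close> would exceed its bound \<open>U\<close>. One
      good \<open>y\<close> is enough, since \<open>w\<close> is nonincreasing on the negative axis
      left of \<open>a\<close>.\<close>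
    have "\<exists>y<a. y < 0 \<and> e < w y"
    proof (rule ccontr)
      assume "\<not> ?thesis"
      then have le: "w y \<le> e" if "y < a" "y < 0" for y using that by force
      define b where "b = min a 0 - 1"
      have b: "b < a" "b < 0" by (auto simp: b_def)
      have U: "0 < U" using pos[OF b(1)] f_less[OF b(1)] by linarith
      \<comment> \<open>The distance from \<open>x\<close> to \<open>b\<close> is such that a slope
        of at most \<open>e / C\<close> makes \<open>f\<close> fall by at least
        \<open>U\<close>.\<close>
      define x where "x = b - C * U / (- e)"
      have "0 < C * U / (- e)" using C U \<open>e < 0\<close> by (intro divide_pos_pos) auto
      then have x: "x < b" by (simp add: x_def)
      have "f b + (- e / C) * b \<le> f x + (- e / C) * x"
      proof (rule DERIV_nonpos_imp_nonincreasing[of x b "\<lambda>x. f x + (- e / C) * x"])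
        fix s assume "x \<le> s" "s \<le> b"
        then have s: "s < a" "s < 0" using b by auto
        have "c (f s) * F s \<le> e" using le[OF s] by (simp add: w_def)
        moreover have "C * F s \<le> c (f s) * F s"
          using C(2)[of "f s"] pos[OF s(1)] f_less[OF s(1)] F_neg[OF s(1)]
          by (intro mult_right_mono_neg) auto
        ultimately have "F s + (- e / C) \<le> 0" using C(1) by (simp add: field_simps)
        moreover have "((\<lambda>x. f x + (- e / C) * x) has_real_derivative F s + (- e / C)) (at s)"
          by (rule derivative_eq_intros f s refl)+ simp
        ultimately show "\<exists>d. ((\<lambda>x. f x + (- e / C) * x) has_real_derivative d) (at s) \<and> d \<le> 0"
          by blast
      qed (use x in auto)
      moreover have "(- e / C) * b - (- e / C) * x = U"
        using C(1) \<open>e < 0\<close> by (simp add: x_def field_simps)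
      ultimately show False using f_less[of x] pos[OF b(1)] x b by linarith
    qed
    then obtain y where y: "y < a" "y < 0" "e < w y" by blast
    show "\<forall>\<^sub>F x in at_bot. e < w x"
      using eventually_le_at_bot[of y]
    proof eventually_elim
      case (elim x) then show ?case using w_dec[OF elim y(1,2)] y(3) by simp
    qed
  next
    fix e :: real assume "0 < e"
    show "\<forall>\<^sub>F x in at_bot. w x < e"
      using eventually_gt_at_bot[of a]
    proof eventually_elim
      case (elim x) then show ?case using w_neg[OF elim] \<open>0 < e\<close> by simp
    qed
  qed
  then show "((\<lambda>x. c (f x) * F x) \<longlongrightarrow> 0) at_bot" by (simp add: w_def[abs_def])
qed

section \<open>From a solution back to the boundary value problem, and uniqueness\<close>

text \<open>L'Hopital's rule applied to the difference quotient. It supplies the derivative of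
  \<open>h\<close> at the value \<open>0\<close>, where the inverse of \<open>f\<close> is only
  known to be continuous.\<close>

lemma has_derivative_at_exceptional_point:
  fixes h k :: "real \<Rightarrow> real"
  assumes "A < z" "z < B" and cont: "isCont h z" "isCont k z"
    and der: "\<And>x. A < x \<Longrightarrow> x < B \<Longrightarrow> x \<noteq> z \<Longrightarrow> (h has_real_derivative k x) (at x)"
  shows "(h has_real_derivative k z) (at z)"
proof -
  have ev: "\<forall>\<^sub>F x in at z. A < x \<and> x < B \<and> x \<noteq> z"
    using eventually_at_in_open[of "{A<..<B}" z] assms(1,2) by (auto elim: eventually_mono)
  have "((\<lambda>x. (h x - h z) / (x - z)) \<longlongrightarrow> k z) (at z)"
  proof (rule lhopital[where f' = k and g' = "\<lambda>_. 1"])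
    show "((\<lambda>x. h x - h z) \<longlongrightarrow> 0) (at z)"
      using cont(1) by (simp add: isCont_def LIM_zero)
    show "((\<lambda>x. x - z) \<longlongrightarrow> 0) (at z)" by (simp add: LIM_zero)
    show "\<forall>\<^sub>F x in at z. x - z \<noteq> 0"
      using ev by eventually_elim auto
    show "\<forall>\<^sub>F x in at z. ((\<lambda>x. h x - h z) has_real_derivative k x) (at x)"
      using ev by eventually_elim (auto intro!: derivative_eq_intros der)
    show "\<forall>\<^sub>F x in at z. ((\<lambda>x. x - z) has_real_derivative 1) (at x)"
      by (auto intro!: always_eventually derivative_eq_intros)
    show "((\<lambda>x. k x / 1) \<longlongrightarrow> k z) (at z)" using cont(2) by (simp add: isCont_def)
  qed auto
  then show ?thesis by (simp add: has_field_derivative_iff)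
qed

context two_phase
begin

text \<open>\<open>g\<close> is the inverse of the decreasing function \<open>f\<close>, and
  \<open>h\<close> is minus the flux composed with \<open>g\<close>. Flux matching makes
  \<open>h\<close> continuous at \<open>0\<close>, and decay of the flux at infinity gives its zero
  boundary values.\<close>

lemma solution_hodograph:
  assumes sol: "free_boundary_solution \<phi> \<epsilon> U V f a"
  obtains g h where "\<And>x. - V < f x" "\<And>x. f x < U" "\<And>x. g (f x) = x"
    "\<And>u. - V < u \<Longrightarrow> u < U \<Longrightarrow> f (g u) = u" "f a = 0"
    "continuous_on {- V..U} h" "h (- V) = 0" "h U = 0"
    "continuous_on {- V<..<U} (\<lambda>u. g u / 2)"
    "\<And>u. - V < u \<Longrightarrow> u < U \<Longrightarrow> (h has_real_derivative g u / 2) (at u)"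
    "\<And>u. - V < u \<Longrightarrow> u < U \<Longrightarrow> u \<noteq> 0 \<Longrightarrow> 0 < h u"
    "\<And>u. - V < u \<Longrightarrow> u < U \<Longrightarrow> u \<noteq> 0 \<Longrightarrow> ((\<lambda>u. g u / 2) has_real_derivative - r u / h u) (at u)"
proof -
  define F where "F = deriv f"
  have f_cont: "isCont f x" for x
    using sol by (auto simp: free_boundary_solution_def continuous_on_eq_continuous_at)
  have f_pos: "0 < f x" if "x < a" for x
    using sol that by (auto simp: free_boundary_solution_def)
  have f_neg: "f x < 0" if "a < x" for x
    using sol that by (auto simp: free_boundary_solution_def)
  have f_der: "(f has_real_derivative F x) (at x)" if "x \<noteq> a" for x
    using sol that unfolding free_boundary_solution_def C2_on_def F_def
    by (metis field_differentiable_derivI greaterThan_iff lessThan_iff linorder_neqE_linordered_idom)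
  have flux_left: "((\<lambda>x. deriv \<phi> (f x) * F x) has_real_derivative - (1/2) * x * F x) (at x)"
    if "x < a" for x
    using sol that unfolding free_boundary_solution_def F_def by blast
  have flux_right: "((\<lambda>x. \<epsilon> * deriv \<phi> (- f x) * F x) has_real_derivative - (1/2) * x * F x) (at x)"
    if "a < x" for x
    using sol that unfolding free_boundary_solution_def F_def by blast
  have lims: "(f \<longlongrightarrow> U) at_bot" "(f \<longlongrightarrow> - V) at_top" "(f \<longlongrightarrow> 0) (at_left a)" "(f \<longlongrightarrow> 0) (at_right a)"
    using sol unfolding free_boundary_solution_def by blast+
  obtain l where l: "((\<lambda>x. deriv \<phi> (f x) * F x) \<longlongrightarrow> l) (at_left a)"
    "((\<lambda>x. \<epsilon> * deriv \<phi> (- f x) * F x) \<longlongrightarrow> l) (at_right a)"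
  proof -
    obtain l s where "((\<lambda>x. deriv \<phi> (f x) * F x) \<longlongrightarrow> l) (at_left a)"
      and s: "((\<lambda>x. deriv \<phi> (- f x) * F x) \<longlongrightarrow> s) (at_right a)" and "l = \<epsilon> * s"
      using sol unfolding free_boundary_solution_def F_def by blast
    moreover from this have "((\<lambda>x. \<epsilon> * deriv \<phi> (- f x) * F x) \<longlongrightarrow> l) (at_right a)"
      using tendsto_mult_left[OF s, of \<epsilon>] by (simp add: mult.assoc)
    ultimately show thesis using that by blast
  qed
  have fa: "f a = 0"
    using f_cont[of a] lims(3) tendsto_unique[of "at_left a" f "f a" 0]
    by (auto simp: isCont_def filterlim_at_split)
  have left: "\<And>x. x < a \<Longrightarrow> F x < 0" "\<And>x. x < a \<Longrightarrow> f x < U"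
    "((\<lambda>x. deriv \<phi> (f x) * F x) \<longlongrightarrow> 0) at_bot"
    by (rule half_line_flux[OF phi'_cont phi'_pos f_pos f_der flux_left lims(1,3)]; simp)+
  \<comment> \<open>The reflected profile \<open>- f (- x)\<close> satisfies the assumptions of
    \<open>half_line_flux\<close> with \<open>c = \<epsilon> * \<phi>'\<close> and free boundary
    \<open>- a\<close>.\<close>
  have right: "\<And>x. a < x \<Longrightarrow> F x < 0" "\<And>x. a < x \<Longrightarrow> - V < f x"
    and right_lim: "((\<lambda>x. \<epsilon> * deriv \<phi> (- f x) * F x) \<longlongrightarrow> 0) at_top"
  proof -
    have *: "continuous_on {0..} (\<lambda>s. \<epsilon> * deriv \<phi> s)" by (intro continuous_intros phi'_cont)
    have der': "((\<lambda>x. - f (- x)) has_real_derivative F (- x)) (at x)" if "x < - a" for x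
    proof -
      have "((\<lambda>x. f (- x)) has_real_derivative - F (- x)) (at x)"
        using f_der[of "- x"] that by (simp add: DERIV_mirror)
      then show ?thesis by (auto intro!: derivative_eq_intros)
    qed
    have flux': "((\<lambda>x. \<epsilon> * deriv \<phi> (- f (- x)) * F (- x)) has_real_derivative - (1/2) * x * F (- x)) (at x)"
      if "x < - a" for x
      using flux_right[of "- x"] that
        DERIV_mirror[of "\<lambda>x. \<epsilon> * deriv \<phi> (- f x) * F x" "- (1/2) * (- x) * F (- x)" x] by simp
    have lim1: "((\<lambda>x. - f (- x)) \<longlongrightarrow> V) at_bot"
      using tendsto_minus[OF lims(2)] by (simp add: filterlim_at_bot_mirror)
    have "isCont (\<lambda>x. - f (- x)) (- a)"
      by (intro continuous_minus isCont_o2[OF _ f_cont]) simp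
    then have lim2: "((\<lambda>x. - f (- x)) \<longlongrightarrow> 0) (at_left (- a))"
      by (simp add: isCont_def filterlim_at_split fa)
    have pos': "0 < \<epsilon> * deriv \<phi> s" if "0 < s" for s using phi'_pos[OF that] eps by simp
    have fpos': "0 < - f (- x)" if "x < - a" for x using f_neg[of "- x"] that by simp
    note h = half_line_flux[OF * pos' fpos' der' flux' lim1 lim2]
    show "F x < 0" "- V < f x" if "a < x" for x
      using h(1)[of "- x"] h(2)[of "- x"] that by auto
    show "((\<lambda>x. \<epsilon> * deriv \<phi> (- f x) * F x) \<longlongrightarrow> 0) at_top"
      using h(3) by (simp add: filterlim_at_bot_mirror)
  qed
  have range: "- V < f x" "f x < U" for x
    using left(2)[of x] right(2)[of x] f_pos[of x] f_neg[of x] fa U V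
    by (cases x a rule: linorder_cases; force)+
  have f_dec: "f y < f x" if "x < y" for x y
  proof -
    have "- f x < - f y"
    proof (rule increasing_off_point(2)[of "x - 1" "y + 1" "\<lambda>x. - f x" a "\<lambda>x. - F x"])
      show "continuous_on {x - 1<..<y + 1} (\<lambda>x. - f x)"
        by (intro continuous_at_imp_continuous_on ballI continuous_minus f_cont)
      show "0 < - F t" "0 \<le> - F t" if "t \<noteq> a" for t
        using left(1)[of t] right(1)[of t] that by (cases t a rule: linorder_cases; simp)+
    qed (use that in \<open>auto intro!: DERIV_minus f_der\<close>)
    then show ?thesis by simp
  qed
  have f_inj: "x = y" if "f x = f y" for x y
    using f_dec[of x y] f_dec[of y x] that by (cases x y rule: linorder_cases) auto
  define g where "g = inv f"
  have gf: "g (f x) = x" for x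
    unfolding g_def by (rule inv_f_f) (auto intro: injI f_inj)
  have fg: "f (g u) = u" if u: "- V < u" "u < U" for u
  proof -
    obtain x where x: "u < f x"
      using eventually_happens'[OF _ order_tendstoD(1)[OF lims(1) u(2)]] by auto
    obtain y where y: "f y < u"
      using eventually_happens'[OF _ order_tendstoD(2)[OF lims(2) u(1)]] by auto
    have "connected (range f)"
      by (rule connected_continuous_image) (auto intro!: continuous_at_imp_continuous_on f_cont)
    from connectedD_interval[OF this, of "f y" "f x" u] obtain t where "u = f t"
      using x y by auto
    then show ?thesis using gf by simp
  qed
  have g_cont: "isCont g u" if u: "- V < u" "u < U" for u
  proof -
    have "isCont g (f (g u))"
      by (rule isCont_inverse_function[where d = 1]) (auto simp: gf f_cont)
    then show ?thesis using fg[OF u] by simp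
  qed
  have g_dec: "g v < g u" if "- V < u" "u < v" "v < U" for u v
    using f_dec[of "g u" "g v"] fg[of u] fg[of v] that by (cases "g u" "g v" rule: linorder_cases) auto
  have g0: "g 0 = a" using gf[of a] fa by simp
  \<comment> \<open>Minus the flux; the value \<open>- l\<close> at \<open>a\<close> is the common
    one-sided limit and makes \<open>W\<close> continuous there.\<close>
  define W where "W x = (if x < a then - (deriv \<phi> (f x) * F x)
      else if a < x then - (\<epsilon> * deriv \<phi> (- f x) * F x) else - l)" for x
  have W_left: "\<forall>\<^sub>F y in at_left a. - (deriv \<phi> (f y) * F y) = W y"
    by (auto simp: W_def eventually_at_filter)
  have W_right: "\<forall>\<^sub>F y in at_right a. - (\<epsilon> * deriv \<phi> (- f y) * F y) = W y"
    by (auto simp: W_def eventually_at_filter)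
  have W_der: "(W has_real_derivative x / 2 * F x) (at x)" if "x \<noteq> a" for x
  proof (cases "x < a")
    case True
    have "((\<lambda>x. - (deriv \<phi> (f x) * F x)) has_real_derivative x / 2 * F x) (at x)"
      using DERIV_minus[OF flux_left[OF True]] by simp
    then show ?thesis
      by (rule has_field_derivative_transform_within_open[of _ _ _ "{..<a}"]) (use True in \<open>auto simp: W_def\<close>)
  next
    case False
    then have "a < x" using that by simp
    then have "((\<lambda>x. - (\<epsilon> * deriv \<phi> (- f x) * F x)) has_real_derivative x / 2 * F x) (at x)"
      using DERIV_minus[OF flux_right[of x]] by simp
    then show ?thesis
      by (rule has_field_derivative_transform_within_open[of _ _ _ "{a<..}"]) (use \<open>a < x\<close> in \<open>auto simp: W_def\<close>)
  qed
  have W_cont: "isCont W x" for x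
  proof (cases "x = a")
    case True
    have "(W \<longlongrightarrow> - l) (at_left a)" "(W \<longlongrightarrow> - l) (at_right a)"
      by (rule Lim_transform_eventually[OF tendsto_minus[OF l(1)] W_left]
          Lim_transform_eventually[OF tendsto_minus[OF l(2)] W_right])+
    then show ?thesis using True by (simp add: isCont_def filterlim_at_split W_def)
  qed (rule DERIV_isCont[OF W_der])
  have W_eq: "W x = - (2 * r (f x) * F x)" if "x \<noteq> a" for x
    using f_pos[of x] f_neg[of x] that by (cases x a rule: linorder_cases) (auto simp: W_def r_simps)
  have W_pos: "0 < W x" if "x \<noteq> a" for x
  proof -
    have "f x \<noteq> 0" using f_inj[of x a] fa that by auto
    then show ?thesis using r_pos[of "f x"] left(1)[of x] right(1)[of x] W_eq[OF that] that
      by (cases x a rule: linorder_cases) (auto simp: mult_pos_neg)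
  qed
  have W_bot: "(W \<longlongrightarrow> 0) at_bot"
  proof (rule Lim_transform_eventually)
    show "((\<lambda>x. - (deriv \<phi> (f x) * F x)) \<longlongrightarrow> 0) at_bot" using tendsto_minus[OF left(3)] by simp
    show "\<forall>\<^sub>F x in at_bot. - (deriv \<phi> (f x) * F x) = W x"
      using eventually_gt_at_bot[of a] by eventually_elim (simp add: W_def)
  qed
  have W_top: "(W \<longlongrightarrow> 0) at_top"
  proof (rule Lim_transform_eventually)
    show "((\<lambda>x. - (\<epsilon> * deriv \<phi> (- f x) * F x)) \<longlongrightarrow> 0) at_top" using tendsto_minus[OF right_lim] by simp
    show "\<forall>\<^sub>F x in at_top. - (\<epsilon> * deriv \<phi> (- f x) * F x) = W x"
      using eventually_gt_at_top[of a] by eventually_elim (simp add: W_def)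
  qed
  \<comment> \<open>The default \<open>0\<close> provides the boundary values at \<open>- V\<close>
    and \<open>U\<close>.\<close>
  define h where "h u = (if - V < u \<and> u < U then W (g u) else 0)" for u
  have h_ev: "\<forall>\<^sub>F v in nhds u. h v = W (g v)" if "- V < u" "u < U" for u
    using eventually_nhds_in_open[of "{- V<..<U}" u] that by (auto simp: h_def elim!: eventually_mono)
  have h_isCont: "isCont h u" if u: "- V < u" "u < U" for u
    using isCont_cong[OF h_ev[OF u]] isCont_o2[OF g_cont[OF u] W_cont] by simp
  have h_top: "(h \<longlongrightarrow> 0) (at_left U)"
  proof (rule tendstoI)
    fix e :: real assume "0 < e"
    then obtain N where N: "\<And>x. x \<le> N \<Longrightarrow> dist (W x) 0 < e"
      using tendstoD[OF W_bot] by (auto simp: eventually_at_bot_linorder)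
    \<comment> \<open>Since \<open>g\<close> is decreasing, \<open>u > f N\<close> forces
      \<open>g u < N\<close>, where \<open>W\<close> is already small.\<close>
    have "dist (h u) 0 < e" if "f N < u" "u < U" for u
      using N[of "g u"] g_dec[of "f N" u] that range(1)[of N] by (simp add: gf h_def)
    then show "\<forall>\<^sub>F u in at_left U. dist (h u) 0 < e"
      using eventually_at_left_real[OF range(2)[of N]] by (auto elim!: eventually_mono)
  qed
  have h_bot: "(h \<longlongrightarrow> 0) (at_right (- V))"
  proof (rule tendstoI)
    fix e :: real assume "0 < e"
    then obtain N where N: "\<And>x. N \<le> x \<Longrightarrow> dist (W x) 0 < e"
      using tendstoD[OF W_top] by (auto simp: eventually_at_top_linorder)
    have "dist (h u) 0 < e" if "- V < u" "u < f N" for u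
      using N[of "g u"] g_dec[of u "f N"] that range(2)[of N] by (simp add: gf h_def)
    then show "\<forall>\<^sub>F u in at_right (- V). dist (h u) 0 < e"
      using eventually_at_right_real[OF range(1)[of N]] by (auto elim!: eventually_mono)
  qed
  have g_der: "(g has_real_derivative inverse (F (g u))) (at u)" and F_ne: "F (g u) \<noteq> 0" and g_ne: "g u \<noteq> a"
    if u: "- V < u" "u < U" "u \<noteq> 0" for u
  proof -
    show ne: "g u \<noteq> a" using fg[OF u(1,2)] fa u(3) by auto
    then show nz: "F (g u) \<noteq> 0" using left(1)[of "g u"] right(1)[of "g u"]
      by (cases "g u" a rule: linorder_cases) auto
    show "(g has_real_derivative inverse (F (g u))) (at u)"
      by (rule DERIV_inverse_function[OF f_der[OF ne] nz u(1,2) fg g_cont[OF u(1,2)]])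
  qed
  \<comment> \<open>In the chain rule the factor \<open>F (g u)\<close> of \<open>W'\<close> cancels
    against the derivative of \<open>g\<close>.\<close>
  have h_der': "(h has_real_derivative g u / 2) (at u)" if u: "- V < u" "u < U" "u \<noteq> 0" for u
  proof -
    have "((\<lambda>u. W (g u)) has_real_derivative (g u / 2 * F (g u)) * inverse (F (g u))) (at u)"
      by (rule DERIV_chain2[OF W_der[OF g_ne[OF u]] g_der[OF u]])
    then have "((\<lambda>u. W (g u)) has_real_derivative g u / 2) (at u)" using F_ne[OF u] by (simp add: mult.assoc)
    then show ?thesis using DERIV_cong_ev[OF refl h_ev[OF u(1,2)] refl] by simp
  qed
  show thesis
  proof (rule that[of g h])
    show "continuous_on {- V..U} h"
      by (rule continuous_on_IccI)
         (use U V h_top h_bot h_isCont in \<open>auto simp: isCont_def h_def[of U] h_def[of "- V"]\<close>)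
    show "continuous_on {- V<..<U} (\<lambda>u. g u / 2)"
      by (intro continuous_at_imp_continuous_on ballI continuous_intros g_cont) auto
    show "(h has_real_derivative g u / 2) (at u)" if u: "- V < u" "u < U" for u
    proof (cases "u = 0")
      case True
      have "(h has_real_derivative g 0 / 2) (at 0)"
        by (rule has_derivative_at_exceptional_point[where k = "\<lambda>u. g u / 2" and A = "- V" and B = U])
           (use U V in \<open>auto intro!: h_isCont h_der' continuous_intros g_cont\<close>)
      then show ?thesis using True by simp
    qed (rule h_der'[OF u])
    fix u assume u: "- V < u" "u < U" "u \<noteq> 0"
    have hu: "h u = W (g u)" using u by (simp add: h_def)
    show "0 < h u" using W_pos[OF g_ne[OF u]] hu by simp
    have "h u = - (2 * r u * F (g u))" using W_eq[OF g_ne[OF u]] fg[OF u(1,2)] hu by simp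
    then have "- r u / h u = inverse (F (g u)) / 2"
      using r_pos[OF u(3)] F_ne[OF u] by (simp add: field_simps)
    then show "((\<lambda>u. g u / 2) has_real_derivative - r u / h u) (at u)"
      using DERIV_cdivide[OF g_der[OF u], of 2] by (simp only:)
  qed (use range gf fg fa in \<open>auto simp: h_def\<close>)
qed

text \<open>Comparison with \<open>e = 0\<close> identifies \<open>h\<^sub>1\<close> and
  \<open>h\<^sub>2\<close>; their derivatives \<open>g / 2\<close> then coincide, and so do the
  inverses.\<close>

lemma solution_unique:
  assumes "free_boundary_solution \<phi> \<epsilon> U V f\<^sub>1 a\<^sub>1" "free_boundary_solution \<phi> \<epsilon> U V f\<^sub>2 a\<^sub>2"
  shows "f\<^sub>1 = f\<^sub>2 \<and> a\<^sub>1 = a\<^sub>2"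
proof (rule solution_hodograph[OF assms(1)], rule solution_hodograph[OF assms(2)], goal_cases)
  case (1 g\<^sub>1 h\<^sub>1 g\<^sub>2 h\<^sub>2)
  \<comment> \<open>Twelve facts per solution, numbered as in the conclusion of
    \<open>solution_hodograph\<close>.\<close>
  note A = 1(1-12) and B = 1(13-24)
  have h_eq: "h\<^sub>1 u = h\<^sub>2 u" if u: "- V < u" "u < U" for u
  proof -
    have "\<bar>h\<^sub>1 u - h\<^sub>2 u\<bar> \<le> 0"
      by (rule singular_bvp_comparison[OF A(6) B(6) A(9) B(9) A(10) B(10) A(12) B(12) A(11) B(11) r_nonneg])
         (use A(7,8) B(7,8) u in auto)
    then show ?thesis by simp
  qed
  have g_eq: "g\<^sub>1 u = g\<^sub>2 u" if u: "- V < u" "u < U" for u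
  proof -
    have "(h\<^sub>1 has_real_derivative g\<^sub>2 u / 2) (at u)"
      by (rule has_field_derivative_transform_within_open[OF B(10)[OF u], of "{- V<..<U}"])
         (use u h_eq in auto)
    from DERIV_unique[OF A(10)[OF u] this] show ?thesis by simp
  qed
  have f_eq: "f\<^sub>1 x = f\<^sub>2 x" for x
    using B(4)[OF A(1,2)[of x]] g_eq[OF A(1,2)[of x]] A(3)[of x] by simp
  then have "a\<^sub>1 = a\<^sub>2" using A(5) B(3)[of a\<^sub>1] B(3)[of a\<^sub>2] B(5) by simp
  with f_eq show ?case by auto
qed

end

theorem theorem5p18:
  fixes \<phi> :: "real \<Rightarrow> real" and \<epsilon> U\<^sub>0 V\<^sub>0 :: real
  assumes "C2_on UNIV \<phi>"
    and "strict_mono_on {0..} \<phi>"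
    and "strict_mono_on {0..} (deriv \<phi>)"
    and "\<And>s. s > 0 \<Longrightarrow> \<phi> s > 0"
    and "\<phi> 0 = 0"
    and "deriv \<phi> 0 = 0"
    and "(\<integral>\<^sup>+ s\<in>{0<..1}. ennreal (deriv \<phi> s / s) \<partial>lborel) < \<infinity>"
    and "(\<integral>\<^sup>+ s\<in>{1..}. ennreal (deriv \<phi> s / s) \<partial>lborel) = \<infinity>"
    and "\<epsilon> > 0" and "U\<^sub>0 > 0" and "V\<^sub>0 > 0"
  shows "\<exists>!(f, a). free_boundary_solution \<phi> \<epsilon> U\<^sub>0 V\<^sub>0 f a"
proof -
  interpret two_phase \<phi> \<epsilon> U\<^sub>0 V\<^sub>0
    using assms by unfold_locales
  show ?thesis using solution_exists solution_unique by (auto intro!: ex_ex1I)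
qed

end
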